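(* Let $R$ be a complete discrete valuation ring with quotient field $K$ and maximal ideal $P=\pi R$, and let $\Lambda=(P^{\alpha_{ij}})_n$ be a basic tiled $R$-order in $M_n(K)$ which is a $(0,1)$-order, i.e. $\alpha_{ij}\in\{0,1\}$ for all $i,j$. Then every $\sigma\in\operatorname{Aut}(Q(\Lambda))$ is liftable. Consequently, $\operatorname{Aut}_R(\Lambda)\cong\operatorname{Inn}(\Lambda)\rtimes\operatorname{Aut}(Q(\Lambda))$.
   Context: Tiled orders: a tiled $R$-order in $M_n(K)$ is taken in the form $\Lambda=(P^{\alpha_{ij}})_n$, the set of matrices in $M_n(K)$ whose $(i,j)$ entry lies in $P^{\alpha_{ij}}=\pi^{\alpha_{ij}}R$ for all $i,j$, where the $\alpha_{ij}$ are non-negative integers with $\alpha_{ii}=0$ and $\alpha_{ij}+\alpha_{jk}\ge\alpha_{ik}$ for all $i,j,k$. $\Lambda$ is basic if $\alpha_{ij}+\alpha_{ji}>0$ for all $i\ne j$; then $\Lambda$ has exactly $n$ distinct maximal two-sided ideals $M_1,\dots,M_n$, where $M_k$ is obtained from $\Lambda$ by replacing the $R$ in position $(k,k)$ with $P$. Link graph: $Q(\Lambda)$ is the quiver with vertices $1,\dots,n$ and an arrow from $i$ to $j$ (loops $i=j$ allowed) if and only if $M_jM_i\ne M_j\cap M_i$. $\operatorname{Aut}(Q(\Lambda))$ is the group of permutations $\sigma\in S_n$ of the vertices such that there is an arrow $i\to j$ if and only if there is an arrow $\sigma(i)\to\sigma(j)$. Liftable: $\operatorname{Aut}_R(\Lambda)$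 is the group of $R$-algebra automorphisms of $\Lambda$, and $\operatorname{Inn}(\Lambda)$ is the subgroup of conjugations by units of $\Lambda$. Each $\varphi\in\operatorname{Aut}_R(\Lambda)$ permutes the maximal ideals, $\varphi(M_i)=M_{\sigma(i)}$, and the resulting $\sigma\in S_n$ lies in $\operatorname{Aut}(Q(\Lambda))$; this gives a homomorphism $\Phi:\operatorname{Aut}_R(\Lambda)\to\operatorname{Aut}(Q(\Lambda))$, $\varphi\mapsto\sigma$. An element of $\operatorname{Aut}(Q(\Lambda))$ is liftable if it is in the image of $\Phi$. *)

theory Defs
  imports
    "HOL-Analysis.Finite_Cartesian_Product"
    "HOL-Algebra.Ring_Divisibility"
    "HOL-Algebra.Ideal_Product"
    "HOL-Algebra.Bij"
begin

section \<open>Complete discrete valuation rings inside their quotient field\<close>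

definition subring_of_field :: "'k::field set \<Rightarrow> 'k ring" where
  "subring_of_field R =
    \<lparr>carrier = R, monoid.mult = (*), one = 1, ring.zero = 0, add = (+)\<rparr>"

definition discrete_valuation_ring :: "'k::field set \<Rightarrow> bool" where
  "discrete_valuation_ring R \<longleftrightarrow>
     principal_domain (subring_of_field R) \<and>
     \<not> Ring.field (subring_of_field R) \<and>
     (\<exists>!P. maximalideal P (subring_of_field R))"

definition has_quotient_field_UNIV :: "'k::field set \<Rightarrow> bool" where
  "has_quotient_field_UNIV R \<longleftrightarrow> (\<forall>x. \<exists>a\<in>R. \<exists>b\<in>R - {0}. x = a / b)"

definition prime_power :: "'k::field set \<Rightarrow> 'k \<Rightarrow> nat \<Rightarrow> 'k set" where
  "prime_power R \<pi> m = {\<pi> ^ m * r | r. r \<in> R}"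

text \<open>Completeness for the topology defined by the powers of \<open>P = \<pi>R\<close>.  Limits are
  automatically unique when \<open>R\<close> is a discrete valuation ring.\<close>

definition adically_complete :: "'k::field set \<Rightarrow> 'k \<Rightarrow> bool" where
  "adically_complete R \<pi> \<longleftrightarrow>
     (\<forall>f::nat \<Rightarrow> 'k. range f \<subseteq> R \<longrightarrow>
        (\<forall>k. \<exists>N. \<forall>m\<ge>N. \<forall>l\<ge>N. f m - f l \<in> prime_power R \<pi> k) \<longrightarrow>
        (\<exists>x\<in>R. \<forall>k. \<exists>N. \<forall>m\<ge>N. f m - x \<in> prime_power R \<pi> k))"


section \<open>Tiled orders\<close>

text \<open>The finite type \<open>'n\<close> indexes rows and columns, so \<open>n = CARD('n)\<close>.\<close>

definition tiled_exponents :: "('n::finite \<Rightarrow> 'n \<Rightarrow> nat) \<Rightarrow> bool" where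
  "tiled_exponents \<alpha> \<longleftrightarrow> (\<forall>i. \<alpha> i i = 0) \<and> (\<forall>i j k. \<alpha> i j + \<alpha> j k \<ge> \<alpha> i k)"

definition basic_exponents :: "('n::finite \<Rightarrow> 'n \<Rightarrow> nat) \<Rightarrow> bool" where
  "basic_exponents \<alpha> \<longleftrightarrow> (\<forall>i j. i \<noteq> j \<longrightarrow> \<alpha> i j + \<alpha> j i > 0)"

definition tiled_order ::
    "'k::field set \<Rightarrow> 'k \<Rightarrow> ('n::finite \<Rightarrow> 'n \<Rightarrow> nat) \<Rightarrow> ('k^'n^'n) set" where
  "tiled_order R \<pi> \<alpha> = {A. \<forall>i j. A $ i $ j \<in> prime_power R \<pi> (\<alpha> i j)}"

text \<open>The product must be \<open>**\<close>: the operation \<open>*\<close> on \<open>'k^'n^'n\<close> is entrywise.\<close>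

definition tiled_order_ring ::
    "'k::field set \<Rightarrow> 'k \<Rightarrow> ('n::finite \<Rightarrow> 'n \<Rightarrow> nat) \<Rightarrow> ('k^'n^'n) ring" where
  "tiled_order_ring R \<pi> \<alpha> =
    \<lparr>carrier = tiled_order R \<pi> \<alpha>, monoid.mult = (**), one = mat 1,
     ring.zero = 0, add = (+)\<rparr>"

definition max_ideal ::
    "'k::field set \<Rightarrow> 'k \<Rightarrow> ('n::finite \<Rightarrow> 'n \<Rightarrow> nat) \<Rightarrow> 'n \<Rightarrow> ('k^'n^'n) set" where
  "max_ideal R \<pi> \<alpha> k = {A \<in> tiled_order R \<pi> \<alpha>. A $ k $ k \<in> prime_power R \<pi> 1}"


section \<open>The link graph and its automorphism group\<close>

definition link_arrow ::
    "'k::field set \<Rightarrow> 'k \<Rightarrow> ('n::finite \<Rightarrow> 'n \<Rightarrow> nat) \<Rightarrow> 'n \<Rightarrow> 'n \<Rightarrow> bool" where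
  "link_arrow R \<pi> \<alpha> i j \<longleftrightarrow>
     ideal_prod (tiled_order_ring R \<pi> \<alpha>) (max_ideal R \<pi> \<alpha> j) (max_ideal R \<pi> \<alpha> i)
       \<noteq> max_ideal R \<pi> \<alpha> j \<inter> max_ideal R \<pi> \<alpha> i"

definition link_aut ::
    "'k::field set \<Rightarrow> 'k \<Rightarrow> ('n::finite \<Rightarrow> 'n \<Rightarrow> nat) \<Rightarrow> ('n \<Rightarrow> 'n) monoid" where
  "link_aut R \<pi> \<alpha> = BijGroup UNIV
    \<lparr>carrier := {\<sigma> \<in> Bij UNIV.
       \<forall>i j. link_arrow R \<pi> \<alpha> i j \<longleftrightarrow> link_arrow R \<pi> \<alpha> (\<sigma> i) (\<sigma> j)}\<rparr>"


section \<open>Automorphisms of a tiled order\<close>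

text \<open>As in \<^const>\<open>BijGroup\<close>, automorphisms are extensional functions on \<open>\<Lambda>\<close>.
  The matrix \<open>map_matrix ((*) r) A\<close> is the scalar multiple \<open>rA\<close>.\<close>

definition order_aut ::
    "'k::field set \<Rightarrow> 'k \<Rightarrow> ('n::finite \<Rightarrow> 'n \<Rightarrow> nat) \<Rightarrow> ('k^'n^'n \<Rightarrow> 'k^'n^'n) monoid" where
  "order_aut R \<pi> \<alpha> = BijGroup (tiled_order R \<pi> \<alpha>)
    \<lparr>carrier := {\<phi> \<in> Bij (tiled_order R \<pi> \<alpha>).
       \<phi> \<in> ring_iso (tiled_order_ring R \<pi> \<alpha>) (tiled_order_ring R \<pi> \<alpha>) \<and>
       (\<forall>r\<in>R. \<forall>A\<in>tiled_order R \<pi> \<alpha>.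
          \<phi> (map_matrix ((*) r) A) = map_matrix ((*) r) (\<phi> A))}\<rparr>"

definition inner_aut ::
    "'k::field set \<Rightarrow> 'k \<Rightarrow> ('n::finite \<Rightarrow> 'n \<Rightarrow> nat) \<Rightarrow> ('k^'n^'n \<Rightarrow> 'k^'n^'n) monoid" where
  "inner_aut R \<pi> \<alpha> = (order_aut R \<pi> \<alpha>)
    \<lparr>carrier := {(\<lambda>A\<in>tiled_order R \<pi> \<alpha>. u ** A ** inv\<^bsub>tiled_order_ring R \<pi> \<alpha>\<^esub> u) | u.
       u \<in> Units (tiled_order_ring R \<pi> \<alpha>)}\<rparr>"

text \<open>The permutation \<open>\<sigma>\<close> with \<open>\<phi>(M\<^sub>k) = M\<^bsub>\<sigma>(k)\<^esub>\<close>.\<close>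

definition induced_perm ::
    "'k::field set \<Rightarrow> 'k \<Rightarrow> ('n::finite \<Rightarrow> 'n \<Rightarrow> nat) \<Rightarrow> ('k^'n^'n \<Rightarrow> 'k^'n^'n) \<Rightarrow> 'n \<Rightarrow> 'n" where
  "induced_perm R \<pi> \<alpha> \<phi> =
     (THE \<sigma>. bij \<sigma> \<and> (\<forall>k. \<phi> ` max_ideal R \<pi> \<alpha> k = max_ideal R \<pi> \<alpha> (\<sigma> k)))"

definition liftable ::
    "'k::field set \<Rightarrow> 'k \<Rightarrow> ('n::finite \<Rightarrow> 'n \<Rightarrow> nat) \<Rightarrow> ('n \<Rightarrow> 'n) \<Rightarrow> bool" where
  "liftable R \<pi> \<alpha> \<sigma> \<longleftrightarrow> \<sigma> \<in> induced_perm R \<pi> \<alpha> ` carrier (order_aut R \<pi> \<alpha>)"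


section \<open>Semidirect products\<close>

definition semidirect_product ::
    "('a, 'm) monoid_scheme \<Rightarrow> ('b, 'l) monoid_scheme \<Rightarrow> ('b \<Rightarrow> 'a \<Rightarrow> 'a) \<Rightarrow> ('a \<times> 'b) monoid" where
  "semidirect_product N H \<theta> =
    \<lparr>carrier = carrier N \<times> carrier H,
     monoid.mult = (\<lambda>(x, g) (y, h). (x \<otimes>\<^bsub>N\<^esub> \<theta> g y, g \<otimes>\<^bsub>H\<^esub> h)),
     one = (\<one>\<^bsub>N\<^esub>, \<one>\<^bsub>H\<^esub>)\<rparr>"

lemma group_semidirect_product:
  assumes N: "Group.group N" and H: "Group.group H" and \<theta>: "\<theta> \<in> hom H (AutoGroup N)"
  shows "Group.group (semidirect_product N H \<theta>)"
proof -
  interpret N: Group.group N by (rule N)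
  interpret H: Group.group H by (rule H)
  interpret A: Group.group "AutoGroup N" by (rule N.AutoGroup)
  interpret \<theta>: group_hom H "AutoGroup N" \<theta>
    using \<theta> by (simp add: group_hom_def group_hom_axioms_def H A.group_axioms)
  have auto: "\<theta> g \<in> auto N" if "g \<in> carrier H" for g
    using \<theta>.hom_closed[OF that] by (simp add: AutoGroup_def)
  have Bij: "\<theta> g \<in> Bij (carrier N)" if "g \<in> carrier H" for g
    using auto[OF that] by (simp add: auto_def)
  have cl: "\<theta> g x \<in> carrier N" if "g \<in> carrier H" "x \<in> carrier N" for g x
    using auto[OF that(1)] that(2) by (auto simp: auto_def hom_def)
  have mult: "\<theta> g (x \<otimes>\<^bsub>N\<^esub> y) = \<theta> g x \<otimes>\<^bsub>N\<^esub> \<theta> g y"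
    if "g \<in> carrier H" "x \<in> carrier N" "y \<in> carrier N" for g x y
    using auto[OF that(1)] that(2,3) by (auto simp: auto_def hom_def)
  have comp: "\<theta> (g \<otimes>\<^bsub>H\<^esub> h) x = \<theta> g (\<theta> h x)"
    if "g \<in> carrier H" "h \<in> carrier H" "x \<in> carrier N" for g h x
    using \<theta>.hom_mult[OF that(1,2)] Bij that
    by (simp add: AutoGroup_def BijGroup_def compose_def)
  have one: "\<theta> \<one>\<^bsub>H\<^esub> x = x" if "x \<in> carrier N" for x
    using \<theta>.hom_one that by (simp add: AutoGroup_def BijGroup_def)
  show ?thesis
  proof (rule groupI)
    fix z assume "z \<in> carrier (semidirect_product N H \<theta>)"
    then obtain x g where z: "z = (x, g)" "x \<in> carrier N" "g \<in> carrier H"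
      by (auto simp: semidirect_product_def)
    let ?y = "(\<theta> (inv\<^bsub>H\<^esub> g) (inv\<^bsub>N\<^esub> x), inv\<^bsub>H\<^esub> g)"
    have inv_g: "inv\<^bsub>H\<^esub> g \<in> carrier H" using z by simp
    define e where "e = \<theta> (inv\<^bsub>H\<^esub> g) \<one>\<^bsub>N\<^esub>"
    have "e \<in> carrier N" "e \<otimes>\<^bsub>N\<^esub> e = e"
      unfolding e_def using cl[OF inv_g] mult[OF inv_g, of "\<one>\<^bsub>N\<^esub>" "\<one>\<^bsub>N\<^esub>"] by auto
    hence "e = \<one>\<^bsub>N\<^esub>" using N.l_cancel_one by blast
    hence "\<theta> (inv\<^bsub>H\<^esub> g) (inv\<^bsub>N\<^esub> x) \<otimes>\<^bsub>N\<^esub> \<theta> (inv\<^bsub>H\<^esub> g) x = \<one>\<^bsub>N\<^esub>"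
      using z mult[OF inv_g, of "inv\<^bsub>N\<^esub> x" x] by (simp add: e_def del: \<theta>.hom_inv)
    thus "\<exists>y\<in>carrier (semidirect_product N H \<theta>).
        y \<otimes>\<^bsub>semidirect_product N H \<theta>\<^esub> z = \<one>\<^bsub>semidirect_product N H \<theta>\<^esub>"
      using z cl[OF inv_g] by (intro bexI[of _ ?y]) (auto simp: semidirect_product_def simp del: \<theta>.hom_inv)
  qed (auto simp: semidirect_product_def cl mult comp one N.m_assoc H.m_assoc
      simp del: \<theta>.hom_mult \<theta>.hom_one)
qed

end

theory Submission
  imports Defs "HOL-Analysis.Cartesian_Space"
begin

text \<open>Order the vertices by \<open>j \<le> i\<close> iff \<open>\<alpha> j i = 0\<close>.  The link graph has an arrow \<open>i \<rightarrow> j\<close> exactly when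
  \<open>i\<close> covers \<open>j\<close>, or \<open>i\<close> is minimal and \<open>j\<close> is maximal.  Give it the weight \<open>\<alpha> j i\<close>, which is \<open>0\<close> on the
  covers and, loops aside, \<open>1\<close> on the other arrows; then \<open>\<alpha> j i\<close> is the least weight of a path from \<open>i\<close> to \<open>j\<close>.
  If \<open>\<beta>\<close> is a second exponent matrix with the same link graph, then either the minimal and
  maximal elements of the two orders agree, and so do the weights, or no element is
  minimal for both.  In the second case the two weights differ by the coboundary of the
  indicator function of the set \<open>U\<close> of all elements lying \<open>\<alpha>\<close>-above some \<open>\<beta>\<close>-minimal element.
  So \<open>\<beta> - \<alpha>\<close> is a coboundary in either case.

  For a link graph automorphism \<open>\<sigma>\<close>, apply this to \<open>\<beta> i j = \<alpha> (\<sigma> i) (\<sigma> j)\<close>: the map that moves the entry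
  \<open>(i, j)\<close> to \<open>(\<sigma> i, \<sigma> j)\<close> and multiplies it by \<open>\<pi>\<close> to the power \<open>\<beta> i j - \<alpha> i j\<close> is an automorphism of
  \<open>\<Lambda>\<close>.  No choice is involved, so it depends multiplicatively on \<open>\<sigma>\<close> and splits \<open>\<Phi>\<close>.  The kernel of
  \<open>\<Phi>\<close> consists of inner automorphisms: modulo an inner one, an automorphism fixing all maximal
  ideals fixes the diagonal idempotents, and such an automorphism is conjugation by a diagonal matrix.\<close>

section \<open>Exponent matrices and their link graphs\<close>

text \<open>Exponent form of \<open>link_arrow\<close>, see \<open>link_arrow_iff\<close>. The left
  side is the exponent of position (j, i) in the intersection of \<open>M j\<close> and
  \<open>M i\<close>, which a loop raises by one; the right side is what a product through
  \<open>k\<close> contributes. For \<open>k = i\<close> or \<open>k = j\<close> a diagonal factor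
  from P makes the contribution smaller anyway.\<close>

definition link :: "('n \<Rightarrow> 'n \<Rightarrow> nat) \<Rightarrow> 'n \<Rightarrow> 'n \<Rightarrow> bool" where
  "link \<alpha> i j \<longleftrightarrow>
     (\<forall>k. k \<noteq> i \<longrightarrow> k \<noteq> j \<longrightarrow> \<alpha> j i + (if i = j then 1 else 0) < \<alpha> j k + \<alpha> k i)"

definition minimal :: "('n \<Rightarrow> 'n \<Rightarrow> nat) \<Rightarrow> 'n \<Rightarrow> bool" where
  "minimal \<alpha> i \<longleftrightarrow> (\<forall>k. \<alpha> k i = 0 \<longrightarrow> k = i)"

definition maximal :: "('n \<Rightarrow> 'n \<Rightarrow> nat) \<Rightarrow> 'n \<Rightarrow> bool" where
  "maximal \<alpha> i \<longleftrightarrow> (\<forall>k. \<alpha> i k = 0 \<longrightarrow> k = i)"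

text \<open>The covering relation of the order, read downwards. Written with \<open>link\<close> and
  \<open>minimal\<close>, it can change only at the minimal elements when two exponent matrices
  share their links.\<close>

definition down_link :: "('n \<Rightarrow> 'n \<Rightarrow> nat) \<Rightarrow> ('n \<times> 'n) set" where
  "down_link \<alpha> = {(i, j). link \<alpha> i j \<and> \<not> minimal \<alpha> i}"

locale zero_one_exponents =
  fixes \<alpha> :: "'n::finite \<Rightarrow> 'n \<Rightarrow> nat"
  assumes diag [simp]: "\<alpha> i i = 0"
    and triangle: "\<alpha> i k \<le> \<alpha> i j + \<alpha> j k"
    and antisym: "\<alpha> i j = 0 \<Longrightarrow> \<alpha> j i = 0 \<Longrightarrow> i = j"
    and le_1: "\<alpha> i j \<le> 1"
begin

lemma trans: "\<alpha> i j = 0 \<Longrightarrow> \<alpha> j k = 0 \<Longrightarrow> \<alpha> i k = 0"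
  using triangle[of i k j] by simp

lemma eq_1_iff: "\<alpha> i j = 1 \<longleftrightarrow> \<alpha> i j \<noteq> 0"
  using le_1[of i j] by linarith

lemma link_if_minimal_maximal:
  assumes "minimal \<alpha> i" "maximal \<alpha> j" shows "link \<alpha> i j"
  unfolding link_def
proof (intro allI impI)
  fix k assume k: "k \<noteq> i" "k \<noteq> j"
  have "\<alpha> k i \<noteq> 0" "\<alpha> j k \<noteq> 0" using assms k by (auto simp: minimal_def maximal_def)
  moreover have "\<alpha> j i + (if i = j then 1 else 0) \<le> 1" using le_1[of j i] by auto
  ultimately show "\<alpha> j i + (if i = j then 1 else 0) < \<alpha> j k + \<alpha> k i" by linarith
qed

text \<open>A sum of two exponents bounded by 1 exceeds 1 only if both are 1, so no other vertex
  lies below \<open>i\<close> or above \<open>j\<close>.\<close>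

lemma link_weight_1:
  assumes l: "link \<alpha> i j" and "i = j \<or> \<alpha> j i \<noteq> 0"
  shows "minimal \<alpha> i" "maximal \<alpha> j"
proof -
  have 1: "\<alpha> j i + (if i = j then 1 else 0) = 1"
    using assms(2) le_1[of j i] by auto
  have "\<alpha> k i \<noteq> 0 \<and> \<alpha> j k \<noteq> 0" if "k \<noteq> i" "k \<noteq> j" for k
  proof -
    have "1 < \<alpha> j k + \<alpha> k i"
      using l[unfolded link_def, rule_format, OF that] unfolding 1 .
    thus ?thesis using le_1[of j k] le_1[of k i] by linarith
  qed
  thus "minimal \<alpha> i" "maximal \<alpha> j"
    unfolding minimal_def maximal_def using assms(2) by (metis less_numeral_extra(3))+
qed

lemma link_from_minimal: "minimal \<alpha> i \<Longrightarrow> link \<alpha> i j \<longleftrightarrow> maximal \<alpha> j"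
  using link_if_minimal_maximal link_weight_1 by (metis minimal_def)

lemma link_to_maximal: "maximal \<alpha> j \<Longrightarrow> link \<alpha> i j \<longleftrightarrow> minimal \<alpha> i"
  using link_if_minimal_maximal link_weight_1 by (metis maximal_def)

lemma down_linkD:
  assumes "(i, j) \<in> down_link \<alpha>" shows "link \<alpha> i j" "\<not> minimal \<alpha> i" "i \<noteq> j" "\<alpha> j i = 0"
  using assms link_weight_1[of i j] by (auto simp: down_link_def)

lemma ex_minimal: "\<exists>a. minimal \<alpha> a \<and> \<alpha> a i = 0"
proof (induction "card {k. \<alpha> k i = 0}" arbitrary: i rule: less_induct)
  case less
  show ?case
  proof (cases "minimal \<alpha> i")
    case False
    then obtain k where k: "\<alpha> k i = 0" "k \<noteq> i" by (auto simp: minimal_def)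
    have "{l. \<alpha> l k = 0} \<subseteq> {l. \<alpha> l i = 0}" using trans[OF _ k(1)] by auto
    moreover have "i \<in> {l. \<alpha> l i = 0} - {l. \<alpha> l k = 0}" using antisym[OF k(1)] k(2) by auto
    ultimately have "card {l. \<alpha> l k = 0} < card {l. \<alpha> l i = 0}"
      by (intro psubset_card_mono finite) blast
    thus ?thesis using less trans[OF _ k(1)] by meson
  qed auto
qed

lemma ex_maximal: "\<exists>b. maximal \<alpha> b \<and> \<alpha> i b = 0"
proof (induction "card {k. \<alpha> i k = 0}" arbitrary: i rule: less_induct)
  case less
  show ?case
  proof (cases "maximal \<alpha> i")
    case False
    then obtain k where k: "\<alpha> i k = 0" "k \<noteq> i" by (auto simp: maximal_def)
    have "{l. \<alpha> k l = 0} \<subseteq> {l. \<alpha> i l = 0}" using trans[OF k(1)] by auto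
    moreover have "i \<in> {l. \<alpha> i l = 0} - {l. \<alpha> k l = 0}" using antisym[OF k(1)] k(2) by auto
    ultimately have "card {l. \<alpha> k l = 0} < card {l. \<alpha> i l = 0}"
      by (intro psubset_card_mono finite) blast
    thus ?thesis using less trans[OF k(1)] by meson
  qed auto
qed

text \<open>A finite order is the reflexive transitive closure of its covers: a pair that is not a
  link has an intermediate \<open>k\<close>, and induction on the size of the interval handles both
  halves.\<close>

lemma down_link_path_iff: "(i, j) \<in> (down_link \<alpha>)\<^sup>* \<longleftrightarrow> \<alpha> j i = 0"
proof
  assume "(i, j) \<in> (down_link \<alpha>)\<^sup>*"
  thus "\<alpha> j i = 0" by induction (auto dest: down_linkD intro: trans)
next
  show "\<alpha> j i = 0 \<Longrightarrow> (i, j) \<in> (down_link \<alpha>)\<^sup>*"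
  proof (induction "card {k. \<alpha> j k = 0 \<and> \<alpha> k i = 0}" arbitrary: i j rule: less_induct)
    case less
    consider "i = j" | "i \<noteq> j" "link \<alpha> i j" | "i \<noteq> j" "\<not> link \<alpha> i j" by blast
    thus ?case
    proof cases
      case 2
      thus ?thesis using less.prems by (force simp: down_link_def minimal_def)
    next
      case 3
      then obtain k where k: "k \<noteq> i" "k \<noteq> j" "\<alpha> j k = 0" "\<alpha> k i = 0"
        using less.prems by (auto simp: link_def)
      let ?I = "\<lambda>x y. {l. \<alpha> x l = 0 \<and> \<alpha> l y = 0}"
      have "?I j k \<subseteq> ?I j i" "?I k i \<subseteq> ?I j i" using trans[OF _ k(4)] trans[OF k(3)] by auto
      moreover have "i \<in> ?I j i - ?I j k" "j \<in> ?I j i - ?I k i"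
        using k less.prems antisym[OF k(3)] antisym[OF k(4)] by auto
      ultimately have "card (?I j k) < card (?I j i)" "card (?I k i) < card (?I j i)"
        by (intro psubset_card_mono finite; blast)+
      hence "(k, j) \<in> (down_link \<alpha>)\<^sup>*" "(i, k) \<in> (down_link \<alpha>)\<^sup>*"
        using less.hyps k by blast+
      thus ?thesis by auto
    qed auto
  qed
qed

text \<open>Weight 0 is reached by descending along covers. For weight 1, descend from
  \<open>i\<close> to a minimal \<open>a\<close>, follow the link to a maximal \<open>b\<close>,
  then descend to \<open>j\<close>. So \<alpha> is the shortest-path distance of its link graph;
  \<open>f\<close> has integer values to allow a shift by a potential.\<close>

lemma le_if_le_on_links:
  fixes f :: "'n \<Rightarrow> 'n \<Rightarrow> int"
  assumes refl: "\<And>i. f i i \<le> 0" and tri: "\<And>i j k. f i k \<le> f i j + f j k"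
    and le: "\<And>i j. i \<noteq> j \<Longrightarrow> link \<alpha> i j \<Longrightarrow> f j i \<le> \<alpha> j i"
  shows "f j i \<le> \<alpha> j i"
proof -
  have zero: "f j i \<le> 0" if "\<alpha> j i = 0" for i j
  proof -
    from that have "(i, j) \<in> (down_link \<alpha>)\<^sup>*" by (simp add: down_link_path_iff)
    thus ?thesis
    proof induction
      case (step j k)
      thus ?case using tri[of k i j] le[of j k] down_linkD[of j k] by force
    qed (rule refl)
  qed
  show ?thesis
  proof (cases "\<alpha> j i = 0")
    case False
    obtain a b where a: "minimal \<alpha> a" "\<alpha> a i = 0" and b: "maximal \<alpha> b" "\<alpha> j b = 0"
      using ex_minimal ex_maximal by meson
    \<comment> \<open>With a = b, \<open>j\<close> would lie below \<open>i\<close>. Loops must be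
      avoided because \<open>le\<close> bounds \<open>f\<close> only off the diagonal.\<close>
    have "a \<noteq> b" using False trans[OF b(2)] a(2) by auto
    hence "f b a \<le> \<alpha> b a" using a b link_if_minimal_maximal le by blast
    moreover have "\<alpha> b a \<le> 1" "\<alpha> j i = 1" using le_1[of b a] False eq_1_iff by blast+
    ultimately show ?thesis
      using tri[of j i b] tri[of b i a] zero[OF a(2)] zero[OF b(2)] by linarith
  qed (use zero in auto)
qed

end

section \<open>Two exponent matrices with the same link graph\<close>

text \<open>Each step of the \<alpha>-path is a link for \<beta> too, and fails to be a
  \<beta>-cover only when it leaves a \<beta>-minimal vertex. The transitive closure records that
  the path really leaves \<open>a\<close>, so its next vertex can be inspected.\<close>

lemma down_link_path_or_minimal:
  assumes "link \<alpha> = link \<beta>" and "(x, y) \<in> (down_link \<alpha>)\<^sup>*"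
  shows "(x, y) \<in> (down_link \<beta>)\<^sup>* \<or>
    (\<exists>a. minimal \<beta> a \<and> (x, a) \<in> (down_link \<alpha>)\<^sup>* \<and> (a, y) \<in> (down_link \<alpha>)\<^sup>+)"
  using assms(2)
proof (induction rule: converse_rtrancl_induct)
  case (step x z)
  show ?case
  proof (cases "minimal \<beta> x")
    case True
    thus ?thesis using step by (meson rtrancl.rtrancl_refl rtrancl_into_trancl2)
  next
    case False
    hence "(x, z) \<in> down_link \<beta>" using step assms(1) by (auto simp: down_link_def)
    thus ?thesis using step by (meson converse_rtrancl_into_rtrancl)
  qed
qed auto

lemma ex_potential:
  fixes \<alpha> \<beta> :: "'n::finite \<Rightarrow> 'n \<Rightarrow> nat"
  assumes \<alpha>: "zero_one_exponents \<alpha>" and \<beta>: "zero_one_exponents \<beta>" and links: "link \<alpha> = link \<beta>"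
  obtains u :: "'n \<Rightarrow> int"
    where "\<And>i j. i \<noteq> j \<Longrightarrow> link \<alpha> i j \<Longrightarrow> int (\<beta> j i) = int (\<alpha> j i) + u i - u j"
proof -
  interpret A: zero_one_exponents \<alpha> by fact
  interpret B: zero_one_exponents \<beta> by fact
  note paths = A.down_link_path_iff B.down_link_path_iff
  show thesis
  proof (cases "\<exists>i. minimal \<alpha> i \<and> minimal \<beta> i")
    case True
    then obtain a where a: "minimal \<alpha> a" "minimal \<beta> a" by blast
    \<comment> \<open>The link targets of the shared minimal vertex are the maximal vertices of both
      orders; the links into one of these then recover the minimal vertices.\<close>
    have max: "maximal \<alpha> j \<longleftrightarrow> maximal \<beta> j" for j
      using A.link_from_minimal B.link_from_minimal a links by metis
    have min: "minimal \<alpha> i \<longleftrightarrow> minimal \<beta> i" for i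
      using A.link_to_maximal B.link_to_maximal A.ex_maximal max links by metis
    have "\<beta> j i = \<alpha> j i" if "i \<noteq> j" "link \<alpha> i j" for i j
    proof (cases "minimal \<alpha> i")
      case True
      hence "\<alpha> j i \<noteq> 0" "\<beta> j i \<noteq> 0" using min that by (auto simp: minimal_def)
      thus ?thesis using A.eq_1_iff B.eq_1_iff by metis
    next
      case False
      thus ?thesis using min that links A.link_weight_1 B.link_weight_1 by metis
    qed
    thus ?thesis using that[of "\<lambda>_. 0"] by simp
  next
    case disj: False
    define U where "U = {i. \<exists>a. minimal \<beta> a \<and> \<alpha> a i = 0}"
    \<comment> \<open>A loop forces its vertex to be minimal for both orders, which is excluded in
      this case.\<close>
    have irrefl: "\<not> link \<alpha> i i" for i
      using disj A.link_weight_1(1) B.link_weight_1(1) links by metis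
    \<comment> \<open>There is a link from \<open>x\<close> to \<open>y\<close>; with
      \<alpha>-weight 1 it would make \<open>x\<close> minimal for \<alpha> too.\<close>
    have below: "\<alpha> y x = 0" if "minimal \<beta> x" "maximal \<beta> y" for x y
      using that B.link_if_minimal_maximal links A.link_weight_1 disj by metis
    have below': "\<beta> y x = 0" if "minimal \<alpha> x" "maximal \<alpha> y" for x y
      using that A.link_if_minimal_maximal links B.link_weight_1 disj by metis
    \<comment> \<open>Otherwise \<open>below\<close> and antisymmetry identify \<open>x\<close> with
      \<open>y\<close>, and this vertex carries a forbidden loop.\<close>
    have not_max: "\<not> (maximal \<beta> y \<and> minimal \<beta> x)" if "\<alpha> x y = 0" for x y
      using that below A.antisym irrefl B.link_if_minimal_maximal links by metis
    have max_notin_U: "y \<notin> U" if "maximal \<beta> y" for y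
      using that not_max by (auto simp: U_def)
    have U_up: "i \<in> U" if "\<alpha> j i = 0" "j \<in> U" for i j
      using that A.trans by (auto simp: U_def)
    \<comment> \<open>By \<open>below'\<close>, the \<beta>-order contains the circle y, b, a, x, y,
      which collapses.\<close>
    have cyc: "x = y" if "minimal \<alpha> a" "\<beta> a x = 0" "maximal \<alpha> b" "\<beta> y b = 0" "\<beta> x y = 0" for x y a b
      using that below' B.antisym B.trans by meson
    \<comment> \<open>Follow a \<beta>-path from \<open>j\<close> down to a \<beta>-minimal vertex.
      Either it is also an \<alpha>-path, which puts \<open>j\<close> in \<open>U\<close>, or it
      meets an \<alpha>-minimal vertex.\<close>
    have reach: "j \<in> U \<or> (\<exists>a. minimal \<alpha> a \<and> \<beta> a j = 0)" for j
    proof -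
      obtain a' where a': "minimal \<beta> a'" "\<beta> a' j = 0" using B.ex_minimal by blast
      thus ?thesis using down_link_path_or_minimal[OF links[symmetric], of j a']
        by (auto simp: U_def paths)
    qed
    have weights: "int (\<beta> j i) = int (\<alpha> j i) + of_bool (i \<in> U) - of_bool (j \<in> U)"
      if "i \<noteq> j" "link \<alpha> i j" for i j
    proof -
      \<comment> \<open>Three kinds of link: \<alpha>-weight 1 and \<beta>-weight 0, entering
        \<open>U\<close>; \<alpha>-weight 0 and \<beta>-weight 1, leaving \<open>U\<close>; and
        common covers, which must not cross the boundary of \<open>U\<close>.\<close>
      consider "minimal \<alpha> i" | "minimal \<beta> i" "\<not> minimal \<alpha> i" | "\<not> minimal \<alpha> i" "\<not> minimal \<beta> i" by blast
      thus ?thesis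
      proof cases
        case 1
        hence max: "maximal \<alpha> j" using that A.link_from_minimal by blast
        have "a = i" if "\<alpha> a i = 0" for a using 1 that by (simp add: minimal_def)
        hence "i \<notin> U" using 1 disj by (auto simp: U_def)
        moreover have "\<beta> j i = 0" using 1 max below' by blast
        moreover have "\<alpha> j i = 1" using 1 that A.eq_1_iff by (metis minimal_def)
        \<comment> \<open>Outside \<open>U\<close>, \<open>j\<close> would have an \<alpha>-minimal
          vertex \<beta>-below it. As \<open>below'\<close> gives the reverse relation,
          \<open>j\<close> would be both \<alpha>-minimal and \<alpha>-maximal and carry a
          loop.\<close>
        moreover have "j \<in> U"
        proof (rule ccontr)
          assume "j \<notin> U"
          then obtain a where "minimal \<alpha> a" "\<beta> a j = 0" using reach by blast
          hence "a = j" using max below' B.antisym by blast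
          thus False using \<open>minimal \<alpha> a\<close> max irrefl A.link_if_minimal_maximal by blast
        qed
        ultimately show ?thesis by simp
      next
        case 2
        hence max: "maximal \<beta> j" using that B.link_from_minimal links by metis
        have "\<beta> j i = 1" using 2 that B.eq_1_iff by (metis minimal_def)
        moreover have "\<alpha> j i = 0" using 2 max below by blast
        moreover have "i \<in> U" using 2 by (auto simp: U_def intro!: exI[of _ i])
        ultimately show ?thesis using max_notin_U max by simp
      next
        case 3
        hence 0: "\<alpha> j i = 0" "\<beta> j i = 0" using that links A.link_weight_1 B.link_weight_1 by metis+
        \<comment> \<open>If \<open>j\<close> were outside \<open>U\<close>, an \<alpha>-path from
          an \<alpha>-maximal \<open>b\<close> down to \<open>i\<close> would also be a
          \<beta>-path, and \<open>cyc\<close> would force \<open>i = j\<close>.\<close>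
        have "j \<in> U" if "i \<in> U"
        proof (rule ccontr)
          assume "j \<notin> U"
          then obtain a where a: "minimal \<alpha> a" "\<beta> a j = 0" using reach by blast
          obtain b where b: "maximal \<alpha> b" "\<alpha> i b = 0" using A.ex_maximal by blast
          have "(b, i) \<in> (down_link \<beta>)\<^sup>*"
          proof (rule ccontr)
            assume "(b, i) \<notin> (down_link \<beta>)\<^sup>*"
            then obtain x where x: "minimal \<beta> x" "(x, i) \<in> (down_link \<alpha>)\<^sup>+"
              using down_link_path_or_minimal[OF links, of b i] b by (auto simp: paths)
            then obtain y where y: "(x, y) \<in> down_link \<alpha>" "(y, i) \<in> (down_link \<alpha>)\<^sup>*"
              by (meson tranclD)
            \<comment> \<open>The path leaves the \<beta>-minimal \<open>x\<close> along a link to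
              \<open>y\<close>, so \<open>y\<close> is \<beta>-maximal; but it lies \<alpha>-above
              \<open>i\<close>, hence in \<open>U\<close>.\<close>
            hence "maximal \<beta> y" using x A.down_linkD(1) B.link_from_minimal links by metis
            thus False using max_notin_U U_up y that by (auto simp: paths)
          qed
          thus False using cyc[OF a(1) _ b(1), of j i] a 0 \<open>i \<noteq> j\<close> by (simp add: paths)
        qed
        thus ?thesis using 0 U_up by auto
      qed
    qed
    show thesis by (rule that[of "\<lambda>i. of_bool (i \<in> U)"]) (rule weights)
  qed
qed

text \<open>Shifting \<beta> by the potential keeps the triangle inequality and gives \<alpha> on
  all links other than loops, so \<open>le_if_le_on_links\<close> yields one inequality. Exchanging
  the two matrices yields the other.\<close>

lemma link_determines_exponents:
  fixes \<alpha> \<beta> :: "'n::finite \<Rightarrow> 'n \<Rightarrow> nat"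
  assumes \<alpha>: "zero_one_exponents \<alpha>" and \<beta>: "zero_one_exponents \<beta>" and links: "link \<alpha> = link \<beta>"
  obtains u :: "'n \<Rightarrow> int" where "\<And>i j. int (\<beta> i j) = int (\<alpha> i j) + u j - u i"
proof -
  interpret A: zero_one_exponents \<alpha> by fact
  interpret B: zero_one_exponents \<beta> by fact
  obtain u :: "'n \<Rightarrow> int"
    where u: "\<And>i j. i \<noteq> j \<Longrightarrow> link \<alpha> i j \<Longrightarrow> int (\<beta> j i) = int (\<alpha> j i) + u i - u j"
    using ex_potential[OF assms] by blast
  have "int (\<beta> j i) + u j - u i \<le> int (\<alpha> j i)" for i j
  proof (rule A.le_if_le_on_links)
    show "int (\<beta> i k) + u i - u k \<le> int (\<beta> i j) + u i - u j + (int (\<beta> j k) + u j - u k)" for i j k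
      using B.triangle[of i k j] by linarith
  qed (use u in auto)
  moreover have "int (\<alpha> j i) + u i - u j \<le> int (\<beta> j i)" for i j
  proof (rule B.le_if_le_on_links)
    show "int (\<alpha> i k) + u k - u i \<le> int (\<alpha> i j) + u j - u i + (int (\<alpha> j k) + u k - u j)" for i j k
      using A.triangle[of i k j] by linarith
  qed (use u links in auto)
  ultimately have "int (\<beta> j i) = int (\<alpha> j i) + u i - u j" for i j
    by (smt (verit))
  thus thesis using that by blast
qed

section \<open>Split extensions\<close>

text \<open>The section writes every \<open>g\<close> uniquely as a kernel element times
  \<open>s (p g)\<close>; moving \<open>s h\<close> past a kernel element produces the conjugation
  \<theta>.\<close>

lemma semidirect_product_of_split_hom:
  fixes G (structure) and H (structure)
  assumes G: "Group.group G" and H: "Group.group H"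
    and s: "s \<in> hom H G" and p: "p \<in> hom G H" and sect: "\<And>h. h \<in> carrier H \<Longrightarrow> p (s h) = h"
  defines "N \<equiv> G\<lparr>carrier := kernel G H p\<rparr>"
  defines "\<theta> \<equiv> (\<lambda>h. \<lambda>n\<in>carrier N. s h \<otimes>\<^bsub>G\<^esub> n \<otimes>\<^bsub>G\<^esub> inv\<^bsub>G\<^esub> (s h))"
  shows "\<theta> \<in> hom H (AutoGroup N)" and "G \<cong> semidirect_product N H \<theta>"
proof -
  interpret G: Group.group G by fact
  interpret H: Group.group H by fact
  interpret s: group_hom H G s using s by unfold_locales
  interpret p: group_hom G H p using p by unfold_locales
  interpret K: Group.group N
    unfolding N_def by (rule G.subgroup_imp_group[OF p.subgroup_kernel])
  have carr: "carrier N = kernel G H p" and mult: "x \<otimes>\<^bsub>N\<^esub> y = x \<otimes>\<^bsub>G\<^esub> y" for x y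
    by (simp_all add: N_def)
  have kerI: "x \<in> carrier G \<Longrightarrow> p x = \<one>\<^bsub>H\<^esub> \<Longrightarrow> x \<in> carrier N"
    and kerD: "x \<in> carrier N \<Longrightarrow> x \<in> carrier G" "x \<in> carrier N \<Longrightarrow> p x = \<one>\<^bsub>H\<^esub>" for x
    by (auto simp: carr kernel_def)
  have conj_closed: "s h \<otimes>\<^bsub>G\<^esub> n \<otimes>\<^bsub>G\<^esub> inv\<^bsub>G\<^esub> (s h) \<in> carrier N" if "h \<in> carrier H" "n \<in> carrier N" for h n
    using that kerD by (intro kerI) (simp_all add: sect)
  have \<theta>_comp: "\<theta> (h \<otimes>\<^bsub>H\<^esub> h') = compose (carrier N) (\<theta> h) (\<theta> h')"
    if "h \<in> carrier H" "h' \<in> carrier H" for h h'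
    using that kerD conj_closed
    by (auto simp: \<theta>_def compose_def G.inv_mult_group G.m_assoc simp del: s.hom_inv intro!: restrict_ext)
  have \<theta>_one: "\<theta> \<one>\<^bsub>H\<^esub> = (\<lambda>n\<in>carrier N. n)"
    using kerD by (auto simp: \<theta>_def intro!: restrict_ext)
  have \<theta>_Bij: "\<theta> h \<in> Bij (carrier N)" if h: "h \<in> carrier H" for h
  proof -
    have inv: "\<theta> (inv\<^bsub>H\<^esub> h) (\<theta> h n) = n" "\<theta> h (\<theta> (inv\<^bsub>H\<^esub> h) n) = n" if n: "n \<in> carrier N" for n
    proof -
      have "compose (carrier N) (\<theta> (inv\<^bsub>H\<^esub> h)) (\<theta> h) n = n"
           "compose (carrier N) (\<theta> h) (\<theta> (inv\<^bsub>H\<^esub> h)) n = n"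
        using h n by (simp_all flip: \<theta>_comp add: \<theta>_one)
      thus "\<theta> (inv\<^bsub>H\<^esub> h) (\<theta> h n) = n" "\<theta> h (\<theta> (inv\<^bsub>H\<^esub> h) n) = n"
        using n by (simp_all add: compose_def)
    qed
    have "\<theta> h \<in> carrier N \<rightarrow> carrier N" "\<theta> (inv\<^bsub>H\<^esub> h) \<in> carrier N \<rightarrow> carrier N"
      using h conj_closed[OF h] conj_closed[of "inv\<^bsub>H\<^esub> h"] by (simp_all add: \<theta>_def del: s.hom_inv)
    hence "bij_betw (\<theta> h) (carrier N) (carrier N)"
      using inv by (intro bij_betw_byWitness[where f' = "\<theta> (inv\<^bsub>H\<^esub> h)"]) auto
    thus ?thesis by (simp add: Bij_def \<theta>_def)
  qed
  have \<theta>_auto: "\<theta> h \<in> auto N" if h: "h \<in> carrier H" for h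
  proof -
    have "\<theta> h (x \<otimes>\<^bsub>N\<^esub> y) = \<theta> h x \<otimes>\<^bsub>N\<^esub> \<theta> h y" if "x \<in> carrier N" "y \<in> carrier N" for x y
    proof -
      have "inv\<^bsub>G\<^esub> (s h) \<otimes>\<^bsub>G\<^esub> (s h \<otimes>\<^bsub>G\<^esub> z) = z" if "z \<in> carrier G" for z
        using h that by (simp flip: G.m_assoc del: s.hom_inv)
      thus ?thesis
        using that h kerD K.m_closed[OF that] by (simp add: \<theta>_def mult G.m_assoc del: s.hom_inv)
    qed
    thus ?thesis using \<theta>_Bij[OF h] by (auto simp: auto_def hom_def dest: Bij_imp_funcset)
  qed
  show \<theta>: "\<theta> \<in> hom H (AutoGroup N)"
    using \<theta>_auto \<theta>_Bij \<theta>_comp by (auto simp: hom_def AutoGroup_def BijGroup_def)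
  interpret S: Group.group "semidirect_product N H \<theta>"
    by (rule group_semidirect_product[OF K.group_axioms H \<theta>])
  define f where "f = (\<lambda>(n, h). n \<otimes>\<^bsub>G\<^esub> s h)"
  have "f \<in> hom (semidirect_product N H \<theta>) G"
  proof (rule homI)
    fix x y assume xy: "x \<in> carrier (semidirect_product N H \<theta>)" "y \<in> carrier (semidirect_product N H \<theta>)"
    obtain n h n' h' where [simp]: "x = (n, h)" "y = (n', h')" by (cases x; cases y)
    have *: "n \<in> carrier N" "h \<in> carrier H" "n' \<in> carrier N" "h' \<in> carrier H"
      using xy by (auto simp: semidirect_product_def)
    have "inv\<^bsub>G\<^esub> (s h) \<otimes>\<^bsub>G\<^esub> (s h \<otimes>\<^bsub>G\<^esub> s h') = s h'"
      using * by (simp flip: G.m_assoc del: s.hom_inv)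
    thus "f (x \<otimes>\<^bsub>semidirect_product N H \<theta>\<^esub> y) = f x \<otimes>\<^bsub>G\<^esub> f y"
      using * kerD by (simp add: f_def semidirect_product_def \<theta>_def mult G.m_assoc del: s.hom_inv)
  qed (auto simp: f_def semidirect_product_def kerD)
  moreover have "bij_betw f (carrier (semidirect_product N H \<theta>)) (carrier G)"
  proof (rule bij_betw_byWitness[where f' = "\<lambda>g. (g \<otimes>\<^bsub>G\<^esub> inv\<^bsub>G\<^esub> (s (p g)), p g)"])
    show "\<forall>x\<in>carrier (semidirect_product N H \<theta>). (f x \<otimes>\<^bsub>G\<^esub> inv\<^bsub>G\<^esub> (s (p (f x))), p (f x)) = x"
      using kerD by (auto simp: semidirect_product_def f_def sect G.m_assoc simp del: s.hom_inv)
    show "\<forall>g\<in>carrier G. f (g \<otimes>\<^bsub>G\<^esub> inv\<^bsub>G\<^esub> (s (p g)), p g) = g"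
      by (auto simp: f_def G.m_assoc simp del: s.hom_inv)
    show "f ` carrier (semidirect_product N H \<theta>) \<subseteq> carrier G"
      using kerD by (auto simp: f_def semidirect_product_def)
    show "(\<lambda>g. (g \<otimes>\<^bsub>G\<^esub> inv\<^bsub>G\<^esub> (s (p g)), p g)) ` carrier G \<subseteq> carrier (semidirect_product N H \<theta>)"
      by (auto simp: semidirect_product_def sect simp del: s.hom_inv p.hom_inv intro!: kerI)
         (simp add: sect p.hom_inv)
  qed
  ultimately have "semidirect_product N H \<theta> \<cong> G" by (auto simp: iso_def is_iso_def)
  thus "G \<cong> semidirect_product N H \<theta>" by (rule S.iso_sym)
qed

section \<open>Valuation rings\<close>

text \<open>Working form of a valuation ring inside its field: \<pi> is a non-unit, and locality
  says that everything outside \<pi>R has its field inverse in R.\<close>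

locale dvr =
  fixes R :: "'k::field set" and \<pi> :: 'k
  assumes zero_in [simp]: "0 \<in> R" and one_in [simp]: "1 \<in> R"
    and add_in: "x \<in> R \<Longrightarrow> y \<in> R \<Longrightarrow> x + y \<in> R"
    and mult_in: "x \<in> R \<Longrightarrow> y \<in> R \<Longrightarrow> x * y \<in> R"
    and minus_in: "x \<in> R \<Longrightarrow> - x \<in> R"
    and pi_in: "\<pi> \<in> R" and pi_nonzero [simp]: "\<pi> \<noteq> 0" and inverse_pi: "inverse \<pi> \<notin> R"
    and inverse_in: "x \<in> R \<Longrightarrow> x \<notin> prime_power R \<pi> 1 \<Longrightarrow> inverse x \<in> R"

lemma dvr_of_discrete_valuation_ring:
  fixes R :: "'k::field set"
  assumes "discrete_valuation_ring R" and \<pi>: "\<pi> \<in> R"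
    and max: "maximalideal (PIdl\<^bsub>subring_of_field R\<^esub> \<pi>) (subring_of_field R)"
  shows "dvr R \<pi>"
proof -
  let ?S = "subring_of_field R"
  have sel: "carrier ?S = R" "x \<otimes>\<^bsub>?S\<^esub> y = x * y" "\<one>\<^bsub>?S\<^esub> = 1" "\<zero>\<^bsub>?S\<^esub> = 0" "x \<oplus>\<^bsub>?S\<^esub> y = x + y" for x y
    by (simp_all add: subring_of_field_def)
  interpret principal_domain ?S using assms(1) by (simp add: discrete_valuation_ring_def)
  have pidl: "PIdl\<^bsub>?S\<^esub> \<pi> = prime_power R \<pi> 1"
    by (auto simp: cgenideal_def prime_power_def sel mult.commute)
  have unique: "I = prime_power R \<pi> 1" if "maximalideal I ?S" for I
    using that max assms(1) unfolding discrete_valuation_ring_def pidl by blast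
  have mult: "x * y \<in> R" if "x \<in> R" "y \<in> R" for x y
    using m_closed[of x y] that by (simp add: sel)
  show ?thesis
  proof
    show "0 \<in> R" "1 \<in> R" "\<pi> \<in> R" using zero_closed one_closed \<pi> by (simp_all add: sel)
    show "x + y \<in> R" "x * y \<in> R" if "x \<in> R" "y \<in> R" for x y
      using a_closed[of x y] mult that by (simp_all add: sel)
    show "- x \<in> R" if "x \<in> R" for x
      using that a_inv_closed[of x] l_neg[of x] by (simp add: sel eq_neg_iff_add_eq_0[symmetric])
    show "\<pi> \<noteq> 0"
    proof
      assume "\<pi> = 0"
      moreover have "0 \<in> R" using zero_closed by (simp add: sel)
      ultimately have "PIdl\<^bsub>?S\<^esub> \<pi> = {\<zero>\<^bsub>?S\<^esub>}" unfolding pidl by (auto simp: prime_power_def sel)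
      thus False
        using max zeromaximalideal_eq_field assms(1) by (simp add: discrete_valuation_ring_def)
    qed
    show "inverse \<pi> \<notin> R"
    proof
      assume "inverse \<pi> \<in> R"
      hence "x = \<pi> ^ 1 * (inverse \<pi> * x)" "inverse \<pi> * x \<in> R" if "x \<in> R" for x
        using that mult \<open>\<pi> \<noteq> 0\<close> by auto
      hence "R \<subseteq> prime_power R \<pi> 1" unfolding prime_power_def by blast
      moreover have "prime_power R \<pi> 1 \<subseteq> R" using mult \<pi> by (auto simp: prime_power_def)
      ultimately show False
        using maximalideal.I_notcarr[OF max] by (simp add: pidl sel)
    qed
    \<comment> \<open>A nonzero non-unit of a principal ideal domain has an irreducible divisor,
      which generates a maximal ideal. By uniqueness that ideal is \<pi>R, so it contains the
      non-unit.\<close>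
    show "inverse x \<in> R" if x: "x \<in> R" "x \<notin> prime_power R \<pi> 1" for x
    proof (rule ccontr)
      assume inv: "inverse x \<notin> R"
      have "x \<noteq> 0"
        using x zero_closed by (auto simp: prime_power_def sel)
      have "x \<in> carrier ?S - {\<zero>\<^bsub>?S\<^esub>}" using x \<open>x \<noteq> 0\<close> by (simp add: sel)
      moreover have "x \<notin> Units ?S"
      proof
        assume "x \<in> Units ?S"
        then obtain y where "y \<in> R" "y * x = 1" by (auto simp: Units_def sel)
        thus False using inv inverse_unique[of x y] by (simp add: mult.commute)
      qed
      ultimately obtain p where p: "p \<in> carrier ?S" "ring_irreducible\<^bsub>?S\<^esub> p" "p divides\<^bsub>?S\<^esub> x"
        by (rule exists_irreducible_divisor)
      have "PIdl\<^bsub>?S\<^esub> p = prime_power R \<pi> 1"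
        using irreducible_imp_maximalideal[OF p(1,2)] unique by blast
      moreover have "x \<in> PIdl\<^bsub>?S\<^esub> p"
      proof -
        obtain c where "c \<in> R" "x = p * c" using p(3) by (auto simp: factor_def sel)
        hence "x = c \<otimes>\<^bsub>?S\<^esub> p" by (simp add: sel mult.commute)
        thus ?thesis using \<open>c \<in> R\<close> unfolding cgenideal_def sel(1) by blast
      qed
      ultimately show False using x by blast
    qed
  qed
qed

context dvr
begin

abbreviation V :: "nat \<Rightarrow> 'k set" where "V \<equiv> prime_power R \<pi>"

lemma V_iff: "x \<in> V m \<longleftrightarrow> x / \<pi> ^ m \<in> R"
  by (force simp: prime_power_def field_simps)

lemma V_0 [simp]: "V 0 = R" by (auto simp: V_iff)

lemma zero_V [simp]: "0 \<in> V m" by (simp add: V_iff)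

lemma V_add: "x \<in> V m \<Longrightarrow> y \<in> V m \<Longrightarrow> x + y \<in> V m"
  by (simp add: V_iff add_divide_distrib add_in)

lemma V_minus: "x \<in> V m \<Longrightarrow> - x \<in> V m"
  using minus_in by (simp add: V_iff)

lemma V_sum: "(\<And>i. i \<in> I \<Longrightarrow> f i \<in> V m) \<Longrightarrow> sum f I \<in> V m"
  by (induction I rule: infinite_finite_induct) (auto intro: V_add)

lemma V_mult: "x \<in> V m \<Longrightarrow> y \<in> V k \<Longrightarrow> x * y \<in> V (m + k)"
  using mult_in[of "x / \<pi> ^ m" "y / \<pi> ^ k"] by (simp add: V_iff power_add)

lemma pi_power_in: "\<pi> ^ m \<in> R"
  by (induction m) (auto intro: mult_in pi_in)

lemma V_mono: assumes "m \<le> k" "x \<in> V k" shows "x \<in> V m"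
proof -
  have "x / \<pi> ^ m = x / \<pi> ^ k * \<pi> ^ (k - m)"
    using assms(1) by (simp add: power_diff)
  thus ?thesis using assms(2) mult_in[OF _ pi_power_in, of "x / \<pi> ^ k" "k - m"] by (simp add: V_iff)
qed

lemma V_mult_le: "x \<in> V m \<Longrightarrow> y \<in> V k \<Longrightarrow> l \<le> m + k \<Longrightarrow> x * y \<in> V l"
  using V_mult V_mono by blast

lemma pi_power_V [simp]: "\<pi> ^ m \<in> V m" by (simp add: V_iff)

lemma pi_power_not_V: "\<pi> ^ m \<notin> V (Suc m)"
  using inverse_pi by (simp add: V_iff field_simps)

lemma one_not_V [simp]: "1 \<notin> V (Suc 0)"
  using pi_power_not_V[of 0] by simp

lemma unit_V: "x \<in> R \<Longrightarrow> x \<notin> V 1 \<Longrightarrow> inverse x \<in> R" "x \<notin> V 1 \<Longrightarrow> x \<noteq> 0"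
  using inverse_in by auto

lemma pi_powi_mult_V:
  assumes "x \<in> V m" "int k = int m + c" shows "\<pi> powi c * x \<in> V k"
proof -
  have "\<pi> ^ k = \<pi> powi c * \<pi> ^ m"
    using assms(2) by (simp flip: power_int_of_nat power_int_add add: add.commute)
  thus ?thesis using assms(1) by (simp add: V_iff)
qed

end

section \<open>Maximal ideals and the link graph of a tiled order\<close>

text \<open>The coefficient is built in because the matrix unit with entry 1 lies in the order only
  where the exponent is 0.\<close>

definition munit :: "'n \<Rightarrow> 'n \<Rightarrow> 'a::zero \<Rightarrow> 'a^'n::finite^'n" where
  "munit a b x = (\<chi> i j. if i = a \<and> j = b then x else 0)"

lemma munit_nth [simp]: "munit a b x $ i $ j = (if i = a \<and> j = b then x else 0)"
  by (simp add: munit_def)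

lemma matrix_mult_nth: "(A ** B) $ i $ j = (\<Sum>k\<in>UNIV. A $ i $ k * B $ k $ j)"
  by (simp add: matrix_matrix_mult_def)

lemma matrix_add_rdistrib: "(A + B) ** C = A ** C + B ** (C :: 'a::semiring_1^'n^'m::finite)"
  by (simp add: vec_eq_iff matrix_mult_nth distrib_right sum.distrib)

lemma matrix_mult_sum_distrib: "A ** (\<Sum>i\<in>I. f i) = (\<Sum>i\<in>I. A ** (f i :: 'a::semiring_1^'n^'m::finite))"
  by (simp add: vec_eq_iff matrix_mult_nth sum_distrib_left) (intro allI sum.swap)

lemma matrix_mult_0_left: "0 ** (A :: 'a::semiring_1^'n^'m::finite) = 0"
  by (simp add: vec_eq_iff matrix_mult_nth)

lemma munit_mult_nth [simp]: "(munit a b x ** A) $ i $ j = (if i = a then x * A $ b $ j else 0)"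
  by (simp add: matrix_mult_nth if_distrib[of "\<lambda>x. x * _"] cong: if_cong)

lemma mult_munit_nth [simp]: "(A ** munit a b x) $ i $ j = (if j = b then A $ i $ a * x else 0)"
  by (simp add: matrix_mult_nth if_distrib[of "\<lambda>x. _ * x"] cong: if_cong)

lemma munit_mult_munit: "munit a b x ** munit b c y = munit a c (x * y)"
  by (simp add: vec_eq_iff)

lemma munit_mult_mult_munit: "munit a a 1 ** A ** munit b b 1 = munit a b (A $ a $ b)"
  by (simp add: vec_eq_iff)

lemma mat_nth: "mat x $ i $ j = (if i = j then x else 0)"
  by (simp add: mat_def)

lemma sum_munit_1: "(\<Sum>i\<in>UNIV. munit i i 1) = (mat 1 :: 'a::semiring_1^'b::finite^'b)"
proof -
  have "(\<Sum>x\<in>UNIV. if i = x \<and> j = x then 1 else 0) = (if i = j then 1 else (0::'a))" for i j :: 'b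
    by (cases "i = j") (auto intro: sum.neutral)
  thus ?thesis by (simp add: vec_eq_iff mat_nth)
qed

lemma matrix_eq_sum_munit:
  fixes A :: "'a::comm_monoid_add^'n::finite^'n"
  shows "A = (\<Sum>a\<in>UNIV. \<Sum>b\<in>UNIV. munit a b (A $ a $ b))"
proof -
  have "(\<Sum>a\<in>UNIV. \<Sum>b\<in>UNIV. munit a b (A $ a $ b)) $ i $ j
      = (\<Sum>a\<in>UNIV. if i = a then A $ a $ j else 0)" for i j
  proof -
    have "(\<Sum>b\<in>UNIV. munit a b (A $ a $ b)) $ i $ j = (if i = a then A $ a $ j else 0)" for a
      by (cases "i = a") auto
    thus ?thesis by simp
  qed
  thus ?thesis by (simp add: vec_eq_iff)
qed

lemma diag_mult_nth:
  "((\<chi> i j. if i = j then c i else 0) ** A) $ i $ j = c i * A $ i $ j"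
  by (simp add: matrix_mult_nth if_distrib[of "\<lambda>x. x * _"] cong: if_cong)

lemma diag_mult_mult_nth:
  "((\<chi> i j. if i = j then c i else 0) ** A ** (\<chi> i j. if i = j then d i else 0)) $ i $ j = c i * A $ i $ j * d j"
  by (simp add: matrix_mult_nth if_distrib[of "\<lambda>x. x * _"] if_distrib[of "\<lambda>x. _ * x"] cong: if_cong)

section \<open>The order, its maximal ideals and its units\<close>

locale zero_one_tiled_order = dvr R \<pi> + zero_one_exponents \<alpha>
  for R :: "'k::field set" and \<pi> :: 'k and \<alpha> :: "'n::finite \<Rightarrow> 'n \<Rightarrow> nat"
begin

abbreviation \<Lambda> :: "('k^'n^'n) set" where "\<Lambda> \<equiv> tiled_order R \<pi> \<alpha>"
abbreviation L :: "('k^'n^'n) ring" where "L \<equiv> tiled_order_ring R \<pi> \<alpha>"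
abbreviation M :: "'n \<Rightarrow> ('k^'n^'n) set" where "M \<equiv> max_ideal R \<pi> \<alpha>"

lemma L_sel [simp]: "carrier L = \<Lambda>" "x \<otimes>\<^bsub>L\<^esub> y = x ** y" "\<one>\<^bsub>L\<^esub> = mat 1" "\<zero>\<^bsub>L\<^esub> = 0" "x \<oplus>\<^bsub>L\<^esub> y = x + y"
  by (simp_all add: tiled_order_ring_def)

lemma \<Lambda>_iff: "A \<in> \<Lambda> \<longleftrightarrow> (\<forall>i j. A $ i $ j \<in> V (\<alpha> i j))"
  by (simp add: tiled_order_def)

lemma \<Lambda>_nth: "A \<in> \<Lambda> \<Longrightarrow> A $ i $ j \<in> V (\<alpha> i j)"
  by (simp add: \<Lambda>_iff)

lemma \<Lambda>_diag_nth: "A \<in> \<Lambda> \<Longrightarrow> A $ i $ i \<in> R"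
  using \<Lambda>_nth[of A i i] by simp

lemma one_\<Lambda> [simp]: "mat 1 \<in> \<Lambda>" by (simp add: \<Lambda>_iff mat_nth)

lemma zero_\<Lambda> [simp]: "0 \<in> \<Lambda>" by (simp add: \<Lambda>_iff)

lemma add_\<Lambda>: "A \<in> \<Lambda> \<Longrightarrow> B \<in> \<Lambda> \<Longrightarrow> A + B \<in> \<Lambda>"
  by (simp add: \<Lambda>_iff V_add)

lemma sum_\<Lambda>: "(\<And>i. i \<in> I \<Longrightarrow> f i \<in> \<Lambda>) \<Longrightarrow> sum f I \<in> \<Lambda>"
  by (induction I rule: infinite_finite_induct) (auto intro: add_\<Lambda>)

lemma mult_\<Lambda>: "A \<in> \<Lambda> \<Longrightarrow> B \<in> \<Lambda> \<Longrightarrow> A ** B \<in> \<Lambda>"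
  using triangle by (auto simp: \<Lambda>_iff matrix_mult_nth intro!: V_sum V_mult_le)

lemma scale_\<Lambda>: "r \<in> R \<Longrightarrow> A \<in> \<Lambda> \<Longrightarrow> map_matrix ((*) r) A \<in> \<Lambda>"
  by (auto simp: \<Lambda>_iff intro!: V_mult_le[of _ 0])

lemma munit_\<Lambda>: "x \<in> V (\<alpha> a b) \<Longrightarrow> munit a b x \<in> \<Lambda>"
  by (simp add: \<Lambda>_iff)

lemma munit_1_\<Lambda> [simp]: "munit a a 1 \<in> \<Lambda>"
  by (simp add: munit_\<Lambda>)

lemma diag_\<Lambda>: "(\<And>i. c i \<in> R) \<Longrightarrow> (\<chi> i j. if i = j then c i else 0) \<in> \<Lambda>"
  by (simp add: \<Lambda>_iff)

lemma M_iff: "A \<in> M k \<longleftrightarrow> A \<in> \<Lambda> \<and> A $ k $ k \<in> V 1"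
  by (simp add: max_ideal_def)

lemma M_subset: "M k \<subseteq> \<Lambda>" by (auto simp: M_iff)

lemma munit_1_M_iff: "munit a a 1 \<in> M k \<longleftrightarrow> a \<noteq> k"
  by (auto simp: M_iff)

text \<open>The diagonal idempotent at \<open>l\<close> lies in every maximal ideal
  \<open>M k\<close> except \<open>M l\<close>. This later upgrades inclusions to
  equalities.\<close>

lemma M_inj: "M k \<subseteq> M l \<Longrightarrow> k = l"
  using munit_1_M_iff by (metis subsetD)

text \<open>A product of entries that goes to another vertex and back lies in P, so the (k, k) entry
  is multiplicative modulo P; hence the \<open>M k\<close> are two-sided ideals.\<close>

lemma one_le_cycle: "l \<noteq> k \<Longrightarrow> 1 \<le> \<alpha> k l + \<alpha> l k"
  using antisym[of k l] by (cases "\<alpha> k l = 0"; cases "\<alpha> l k = 0") auto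

lemma mult_M_left: assumes "A \<in> \<Lambda>" "B \<in> M k" shows "A ** B \<in> M k"
proof -
  have "A $ k $ l * B $ l $ k \<in> V 1" for l
    using assms one_le_cycle[of l k]
    by (cases "l = k") (auto simp: M_iff dest: \<Lambda>_nth[of _ k l] \<Lambda>_nth[of _ l k] intro: V_mult_le)
  thus ?thesis using assms mult_\<Lambda> by (simp add: M_iff matrix_mult_nth V_sum)
qed

lemma mult_M_right: assumes "A \<in> M k" "B \<in> \<Lambda>" shows "A ** B \<in> M k"
proof -
  have "A $ k $ l * B $ l $ k \<in> V 1" for l
    using assms one_le_cycle[of l k]
    by (cases "l = k") (auto simp: M_iff dest: \<Lambda>_nth[of _ k l] \<Lambda>_nth[of _ l k] intro: V_mult_le)
  thus ?thesis using assms mult_\<Lambda> by (simp add: M_iff matrix_mult_nth V_sum)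
qed

lemma add_M: "A \<in> M k \<Longrightarrow> B \<in> M k \<Longrightarrow> A + B \<in> M k"
  by (simp add: M_iff add_\<Lambda> V_add)

lemma zero_M [simp]: "0 \<in> M k" by (simp add: M_iff)

lemma sum_M: "(\<And>i. i \<in> I \<Longrightarrow> f i \<in> M k) \<Longrightarrow> sum f I \<in> M k"
  by (induction I rule: infinite_finite_induct) (auto intro: add_M)

lemma ideal_prod_subset: "ideal_prod L (M j) (M i) \<subseteq> M j \<inter> M i"
proof
  show "A \<in> M j \<inter> M i" if "A \<in> ideal_prod L (M j) (M i)" for A
    using that
  proof induction
    case (prod A B)
    thus ?case using mult_M_left[of A B i] mult_M_right[of A j B] M_subset by auto
  qed (auto intro: add_M)
qed

lemma sum_ideal_prod:
  assumes "\<And>i. i \<in> I \<Longrightarrow> f i \<in> ideal_prod L (M k) (M l)"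
  shows "sum f I \<in> ideal_prod L (M k) (M l)"
proof -
  have "0 ** 0 \<in> ideal_prod L (M k) (M l)" using ideal_prod.prod[of 0 "M k" 0 "M l" L] by simp
  hence 0: "0 \<in> ideal_prod L (M k) (M l)" by (simp add: matrix_matrix_mult_def zero_vec_def)
  show ?thesis using assms
    by (induction I rule: infinite_finite_induct) (auto intro: 0 ideal_prod.sum[of _ L, simplified])
qed

text \<open>Only position (j, i) can separate the product from the intersection: off row
  \<open>j\<close> or off column \<open>i\<close> a diagonal idempotent splits off as a factor. At
  (j, i) an entry factors through a third vertex \<open>k\<close> if the exponents permit
  it.\<close>

lemma link_arrow_iff: "link_arrow R \<pi> \<alpha> i j \<longleftrightarrow> link \<alpha> i j"
proof
  assume "link_arrow R \<pi> \<alpha> i j"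
  moreover have "M j \<inter> M i \<subseteq> ideal_prod L (M j) (M i)" if not_link: "\<not> link \<alpha> i j"
  proof
    fix A assume A: "A \<in> M j \<inter> M i"
    have "munit a b (A $ a $ b) \<in> ideal_prod L (M j) (M i)" for a b
    proof -
      have unit_M: "munit a b (A $ a $ b) \<in> M j \<inter> M i"
        using A by (auto simp: M_iff \<Lambda>_nth munit_\<Lambda>)
      consider "a \<noteq> j" | "b \<noteq> i" | "a = j" "b = i" by blast
      thus ?thesis
      proof cases
        case 1
        hence "munit a a 1 \<otimes>\<^bsub>L\<^esub> munit a b (A $ a $ b) \<in> ideal_prod L (M j) (M i)"
          using unit_M by (intro ideal_prod.prod) (auto simp: munit_1_M_iff)
        thus ?thesis by (simp add: munit_mult_munit)
      next
        case 2
        hence "munit a b (A $ a $ b) \<otimes>\<^bsub>L\<^esub> munit b b 1 \<in> ideal_prod L (M j) (M i)"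
          using unit_M by (intro ideal_prod.prod) (auto simp: munit_1_M_iff)
        thus ?thesis by (simp add: munit_mult_munit)
      next
        case 3
        obtain k where k: "k \<noteq> i" "k \<noteq> j" "\<alpha> j k + \<alpha> k i \<le> \<alpha> j i + (if i = j then 1 else 0)"
          using not_link by (auto simp: link_def not_less)
        have "A $ j $ i \<in> V (\<alpha> j i + (if i = j then 1 else 0))"
          using A \<Lambda>_nth[of A j i] by (auto simp: M_iff)
        hence "A $ j $ i \<in> V (\<alpha> j k + \<alpha> k i)" using k(3) V_mono by blast
        then obtain r where r: "r \<in> R" "A $ j $ i = \<pi> ^ \<alpha> j k * (\<pi> ^ \<alpha> k i * r)"
          by (auto simp: prime_power_def power_add mult.assoc)
        have "munit j k (\<pi> ^ \<alpha> j k) \<otimes>\<^bsub>L\<^esub> munit k i (\<pi> ^ \<alpha> k i * r) \<in> ideal_prod L (M j) (M i)"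
          using k(1,2) r(1) by (intro ideal_prod.prod) (auto simp: M_iff V_iff intro!: munit_\<Lambda>)
        thus ?thesis using 3 r by (simp add: munit_mult_munit)
      qed
    qed
    hence "(\<Sum>a\<in>UNIV. \<Sum>b\<in>UNIV. munit a b (A $ a $ b)) \<in> ideal_prod L (M j) (M i)"
      by (intro sum_ideal_prod)
    thus "A \<in> ideal_prod L (M j) (M i)" by (simp flip: matrix_eq_sum_munit)
  qed
  ultimately show "link \<alpha> i j"
    using ideal_prod_subset unfolding link_arrow_def by blast
next
  assume l: "link \<alpha> i j"
  \<comment> \<open>\<open>m\<close> is the least exponent at (j, i) in the intersection, with the
    extra 1 for a loop. Products only reach exponent m + 1, so the entry \<pi>^m separates the
    two.\<close>
  define m where "m = \<alpha> j i + (if i = j then 1 else 0)"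
  have "A $ j $ i \<in> V (Suc m)" if "A \<in> ideal_prod L (M j) (M i)" for A
    using that
  proof induction
    case (prod A B)
    have "A $ j $ k * B $ k $ i \<in> V (Suc m)" for k
    proof -
      have A: "A $ j $ k \<in> V (\<alpha> j k)" "A $ j $ j \<in> V 1" and B: "B $ k $ i \<in> V (\<alpha> k i)" "B $ i $ i \<in> V 1"
        using prod by (auto simp: M_iff \<Lambda>_nth)
      consider "k = j" | "k = i" | "k \<noteq> i" "k \<noteq> j" by blast
      thus ?thesis
      proof cases
        case 3
        hence "Suc m \<le> \<alpha> j k + \<alpha> k i" using l unfolding link_def m_def by (meson Suc_leI)
        thus ?thesis using A B V_mult_le by blast
      qed (use A B V_mult_le[of _ 1 _ 1 "Suc m"] V_mult_le[of _ 1 _ "\<alpha> j i" "Suc m"]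
           V_mult_le[of _ "\<alpha> j i" _ 1 "Suc m"] in \<open>auto simp: m_def split: if_splits\<close>)
    qed
    thus ?case by (simp add: matrix_mult_nth V_sum)
  qed (simp add: V_add)
  moreover have "munit j i (\<pi> ^ m) $ j $ i \<notin> V (Suc m)"
    using pi_power_not_V by simp
  moreover have "munit j i (\<pi> ^ m) \<in> M j \<inter> M i"
  proof -
    have "\<pi> ^ m \<in> V (\<alpha> j i)" by (rule V_mono[OF _ pi_power_V]) (simp add: m_def)
    moreover have "\<pi> ^ m \<in> V 1" if "i = j"
      by (rule V_mono[OF _ pi_power_V]) (simp add: m_def that)
    ultimately show ?thesis by (auto simp: M_iff munit_\<Lambda>)
  qed
  ultimately show "link_arrow R \<pi> \<alpha> i j" unfolding link_arrow_def by blast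
qed

text \<open>Column by column Gaussian elimination inside \<open>\<Lambda>\<close>: the pivots stay units because
  \<open>\<alpha> i k + \<alpha> k i > 0\<close> for \<open>i \<noteq> k\<close>.\<close>

lemma left_inverse_if_unit_diag:
  assumes u: "u \<in> \<Lambda>" and diag: "\<And>i. u $ i $ i \<notin> V 1"
  obtains w where "w \<in> \<Lambda>" "w ** u = mat 1"
proof -
  have "\<exists>w\<in>\<Lambda>. (\<forall>i. (w ** u) $ i $ i \<notin> V 1) \<and> (\<forall>k\<in>S. \<forall>i. i \<noteq> k \<longrightarrow> (w ** u) $ i $ k = 0)" for S
  proof (induction S rule: infinite_finite_induct)
    case empty
    show ?case using diag by (intro bexI[of _ "mat 1"]) auto
  next
    case (insert k S)
    then obtain w where w: "w \<in> \<Lambda>" "\<And>i. (w ** u) $ i $ i \<notin> V 1"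
        "\<And>l i. l \<in> S \<Longrightarrow> i \<noteq> l \<Longrightarrow> (w ** u) $ i $ l = 0" by blast
    define t where "t = w ** u"
    note tdiag = w(2)[folded t_def] and tcol = w(3)[folded t_def]
    have t: "t \<in> \<Lambda>" using w u by (simp add: t_def mult_\<Lambda>)
    define q where "q i = t $ i $ k * inverse (t $ k $ k)" for i
    have q: "q i \<in> V (\<alpha> i k)" for i
      unfolding q_def using tdiag t \<Lambda>_diag_nth
      by (intro V_mult_le[where k = 0]) (auto intro: unit_V \<Lambda>_nth)
    \<comment> \<open>Left multiplication by \<open>v\<close> subtracts \<open>q i\<close> times row
      \<open>k\<close> from every other row \<open>i\<close>; the bound on \<open>q i\<close> keeps
      \<open>v\<close> in the order.\<close>
    define v where "v = (\<chi> i j. if i = j then 1 else if j = k then - q i else 0)"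
    have v: "v \<in> \<Lambda>" using q by (auto simp: \<Lambda>_iff v_def V_minus)
    have vt: "(v ** t) $ i $ l = t $ i $ l - (if i = k then 0 else q i * t $ k $ l)" for i l
    proof -
      have "v $ i $ j * t $ j $ l = (if j = i then t $ i $ l else 0)
          + (if j = k then if i = k then 0 else - (q i * t $ k $ l) else 0)" for j
        by (auto simp: v_def)
      thus ?thesis by (simp add: matrix_mult_nth sum.distrib)
    qed
    have "(v ** t) $ i $ i \<notin> V 1" for i
    proof
      assume 1: "(v ** t) $ i $ i \<in> V 1"
      have "(if i = k then 0 else q i * t $ k $ i) \<in> V 1"
        using q t \<Lambda>_nth one_le_cycle[of k i] by (auto intro!: V_mult_le)
      from V_add[OF 1 this] show False using tdiag by (simp add: vt)
    qed
    \<comment> \<open>In a column of \<open>S\<close> the pivot row has entry 0, so cleared columns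
      stay cleared; in column \<open>k\<close> the choice of \<open>q\<close> cancels the
      entry.\<close>
    moreover have "(v ** t) $ i $ l = 0" if "l \<in> insert k S" "i \<noteq> l" for i l
      using that insert.hyps(2) tcol unit_V(2)[OF tdiag[of k]] by (cases "l = k") (auto simp: vt q_def)
    ultimately show ?case
      using v w(1) by (intro bexI[of _ "v ** w"]) (auto simp: t_def matrix_mul_assoc mult_\<Lambda>)
  qed simp
  from this[of UNIV] obtain w where w: "w \<in> \<Lambda>" "\<And>i. (w ** u) $ i $ i \<notin> V 1"
      "\<And>i k. i \<noteq> k \<Longrightarrow> (w ** u) $ i $ k = 0" by blast
  define d where "d = (\<chi> i j. if i = j then inverse ((w ** u) $ i $ i) else 0)"
  have "d \<in> \<Lambda>"
    unfolding d_def using w u by (intro diag_\<Lambda> unit_V \<Lambda>_diag_nth mult_\<Lambda>)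
  moreover have "(d ** (w ** u)) $ i $ j = mat 1 $ i $ j" for i j
    using w(3) unit_V(2)[OF w(2)] unfolding d_def diag_mult_nth by (simp add: mat_nth)
  ultimately show thesis
    using that[of "d ** w"] w(1) by (simp add: mult_\<Lambda> vec_eq_iff matrix_mul_assoc)
qed

end

section \<open>Automorphisms of a tiled order\<close>

context zero_one_tiled_order
begin

abbreviation Aut where "Aut \<equiv> order_aut R \<pi> \<alpha>"
abbreviation Inn where "Inn \<equiv> inner_aut R \<pi> \<alpha>"
abbreviation Q where "Q \<equiv> link_aut R \<pi> \<alpha>"
abbreviation perm where "perm \<equiv> induced_perm R \<pi> \<alpha>"

lemma Aut_iff:
  "\<phi> \<in> carrier Aut \<longleftrightarrow> \<phi> \<in> Bij \<Lambda> \<and> \<phi> (mat 1) = mat 1 \<and>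
     (\<forall>A\<in>\<Lambda>. \<forall>B\<in>\<Lambda>. \<phi> (A ** B) = \<phi> A ** \<phi> B \<and> \<phi> (A + B) = \<phi> A + \<phi> B) \<and>
     (\<forall>r\<in>R. \<forall>A\<in>\<Lambda>. \<phi> (map_matrix ((*) r) A) = map_matrix ((*) r) (\<phi> A))"
  by (auto simp: order_aut_def ring_iso_def ring_hom_def Bij_def dest: bij_betwE)

lemma AutD:
  assumes "\<phi> \<in> carrier Aut"
  shows "\<phi> \<in> Bij \<Lambda>" "bij_betw \<phi> \<Lambda> \<Lambda>" "A \<in> \<Lambda> \<Longrightarrow> \<phi> A \<in> \<Lambda>" "\<phi> (mat 1) = mat 1"
    "A \<in> \<Lambda> \<Longrightarrow> B \<in> \<Lambda> \<Longrightarrow> \<phi> (A ** B) = \<phi> A ** \<phi> B"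
    "A \<in> \<Lambda> \<Longrightarrow> B \<in> \<Lambda> \<Longrightarrow> \<phi> (A + B) = \<phi> A + \<phi> B"
    "r \<in> R \<Longrightarrow> A \<in> \<Lambda> \<Longrightarrow> \<phi> (map_matrix ((*) r) A) = map_matrix ((*) r) (\<phi> A)"
  using assms by (auto simp: Aut_iff Bij_def dest: bij_betwE)

lemma AutI:
  assumes "\<phi> \<in> extensional \<Lambda>"
    and "\<And>A. A \<in> \<Lambda> \<Longrightarrow> \<phi> A \<in> \<Lambda>" "\<And>A. A \<in> \<Lambda> \<Longrightarrow> \<psi> A \<in> \<Lambda>"
    and "\<And>A. A \<in> \<Lambda> \<Longrightarrow> \<psi> (\<phi> A) = A" "\<And>A. A \<in> \<Lambda> \<Longrightarrow> \<phi> (\<psi> A) = A"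
    and "\<phi> (mat 1) = mat 1" "\<And>A B. A \<in> \<Lambda> \<Longrightarrow> B \<in> \<Lambda> \<Longrightarrow> \<phi> (A ** B) = \<phi> A ** \<phi> B"
    and "\<And>A B. A \<in> \<Lambda> \<Longrightarrow> B \<in> \<Lambda> \<Longrightarrow> \<phi> (A + B) = \<phi> A + \<phi> B"
    and "\<And>r A. r \<in> R \<Longrightarrow> A \<in> \<Lambda> \<Longrightarrow> \<phi> (map_matrix ((*) r) A) = map_matrix ((*) r) (\<phi> A)"
  shows "\<phi> \<in> carrier Aut"
proof -
  have "bij_betw \<phi> \<Lambda> \<Lambda>"
    using assms(2-5) by (intro bij_betw_byWitness[where f' = \<psi>]) auto
  thus ?thesis using assms by (simp add: Aut_iff Bij_def)
qed

lemma Aut_compose: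
  assumes "\<phi> \<in> carrier Aut" "\<psi> \<in> carrier Aut" shows "compose \<Lambda> \<phi> \<psi> \<in> carrier Aut"
proof -
  have "compose \<Lambda> \<phi> \<psi> \<in> Bij \<Lambda>" using assms by (simp add: compose_Bij AutD(1))
  moreover have "compose \<Lambda> \<phi> \<psi> A = \<phi> (\<psi> A)" if "A \<in> \<Lambda>" for A using that by (simp add: compose_def)
  ultimately show ?thesis
    by (simp add: Aut_iff[of "compose \<Lambda> \<phi> \<psi>"] AutD[OF assms(1)] AutD[OF assms(2)] mult_\<Lambda> add_\<Lambda> scale_\<Lambda>)
qed

lemma Aut_inv:
  assumes \<phi>: "\<phi> \<in> carrier Aut" shows "(\<lambda>A\<in>\<Lambda>. inv_into \<Lambda> \<phi> A) \<in> carrier Aut"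
proof -
  let ?\<psi> = "\<lambda>A\<in>\<Lambda>. inv_into \<Lambda> \<phi> A"
  have inv: "?\<psi> A \<in> \<Lambda>" "\<phi> (?\<psi> A) = A" "?\<psi> (\<phi> A) = A" if "A \<in> \<Lambda>" for A
    using that AutD(2,3)[OF \<phi>] Bij_inv_into_mem[OF AutD(1)[OF \<phi>]]
      bij_betw_inv_into_left bij_betw_inv_into_right by fastforce+
  have eqI: "?\<psi> B = A" if "A \<in> \<Lambda>" "\<phi> A = B" for A B
    using inv(3) that by blast
  show ?thesis
    by (rule AutI[where \<psi> = \<phi>])
       (use inv in \<open>auto intro!: eqI simp del: restrict_apply simp: AutD[OF \<phi>] mult_\<Lambda> add_\<Lambda> scale_\<Lambda>\<close>)
qed

lemma subgroup_Aut: "subgroup (carrier Aut) (BijGroup \<Lambda>)"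
proof
  show "\<one>\<^bsub>BijGroup \<Lambda>\<^esub> \<in> carrier Aut"
    by (auto simp: BijGroup_def Aut_iff id_Bij mult_\<Lambda> add_\<Lambda> scale_\<Lambda>)
  show "\<phi> \<otimes>\<^bsub>BijGroup \<Lambda>\<^esub> \<psi> \<in> carrier Aut" if "\<phi> \<in> carrier Aut" "\<psi> \<in> carrier Aut" for \<phi> \<psi>
    using that by (simp add: BijGroup_def AutD(1) Aut_compose)
  show "inv\<^bsub>BijGroup \<Lambda>\<^esub> \<phi> \<in> carrier Aut" if "\<phi> \<in> carrier Aut" for \<phi>
    using that Aut_inv AutD(1) inv_BijGroup by metis
qed (auto simp: BijGroup_def AutD(1))

lemma group_Aut: "Group.group Aut"
  using group.subgroup_imp_group[OF group_BijGroup subgroup_Aut] by (simp add: order_aut_def)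

lemma Aut_mult: "\<phi> \<in> carrier Aut \<Longrightarrow> \<psi> \<in> carrier Aut \<Longrightarrow> \<phi> \<otimes>\<^bsub>Aut\<^esub> \<psi> = compose \<Lambda> \<phi> \<psi>"
  by (simp add: order_aut_def BijGroup_def)

lemma Aut_zero: "\<phi> \<in> carrier Aut \<Longrightarrow> \<phi> 0 = 0"
  using AutD(6)[of \<phi> 0 0] by simp

lemma Aut_sum:
  "\<phi> \<in> carrier Aut \<Longrightarrow> (\<And>i. i \<in> I \<Longrightarrow> f i \<in> \<Lambda>) \<Longrightarrow> \<phi> (sum f I) = (\<Sum>i\<in>I. \<phi> (f i))"
  by (induction I rule: infinite_finite_induct) (auto simp: Aut_zero AutD(6) sum_\<Lambda>)

section \<open>The action of automorphisms on the maximal ideals\<close>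

text \<open>Otherwise, for each \<open>j\<close>, some element of \<open>M k\<close> has an image
  with a unit at (j, j). Cutting with the preimage of the idempotent at \<open>j\<close> and
  rescaling gives elements of \<open>M k\<close> mapped to the diagonal idempotents. Their sum is
  mapped to 1, so 1 would lie in \<open>M k\<close>.\<close>

lemma image_M_subset:
  assumes \<phi>: "\<phi> \<in> carrier Aut" shows "\<exists>j. \<phi> ` M k \<subseteq> M j"
proof (rule ccontr)
  assume "\<nexists>j. \<phi> ` M k \<subseteq> M j"
  hence "\<forall>j. \<exists>x. x \<in> M k \<and> \<phi> x \<notin> M j" by blast
  then obtain x where x: "\<And>j. x j \<in> M k" "\<And>j. \<phi> (x j) \<notin> M j" by metis
  have x_\<Lambda>: "x j \<in> \<Lambda>" for j using x(1) M_subset by blast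
  define r where "r j = inverse (\<phi> (x j) $ j $ j)" for j
  have unit: "\<phi> (x j) $ j $ j \<notin> V 1" for j
    using x x_\<Lambda> AutD(3)[OF \<phi>] by (auto simp: M_iff)
  hence r: "r j \<in> R" for j
    unfolding r_def by (intro unit_V \<Lambda>_diag_nth AutD(3)[OF \<phi>] x_\<Lambda>)
  obtain e where e: "e j \<in> \<Lambda>" "\<phi> (e j) = munit j j 1" for j
  proof -
    have "\<forall>j. \<exists>x\<in>\<Lambda>. \<phi> x = munit j j 1"
      using bij_betw_imp_surj_on[OF AutD(2)[OF \<phi>]] munit_1_\<Lambda> by (metis imageE)
    thus thesis using that by metis
  qed
  define y where "y j = map_matrix ((*) (r j)) (e j ** x j ** e j)" for j
  have "\<phi> (y j) = munit j j 1" for j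
  proof -
    have "\<phi> (y j) = map_matrix ((*) (r j)) (munit j j 1 ** \<phi> (x j) ** munit j j 1)"
      by (simp add: y_def AutD[OF \<phi>] r e x_\<Lambda> mult_\<Lambda>)
    also have "\<dots> = munit j j 1"
      using unit_V(2)[OF unit[of j]] by (auto simp: munit_mult_mult_munit vec_eq_iff r_def)
    finally show ?thesis .
  qed
  moreover have y: "y j \<in> M k" for j
  proof -
    have "e j ** x j ** e j \<in> M k" using x e by (intro mult_M_left mult_M_right)
    thus ?thesis
      using r V_mult_le[of "r j" 0 _ 1 1] by (simp add: M_iff y_def scale_\<Lambda>)
  qed
  ultimately have "\<phi> (\<Sum>j\<in>UNIV. y j) = \<phi> (mat 1)"
    using Aut_sum[OF \<phi>, of UNIV y] M_subset AutD(4)[OF \<phi>] by (auto simp: sum_munit_1)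
  hence "mat 1 \<in> M k"
    using sum_M[of UNIV y k, OF y] bij_betw_imp_inj_on[OF AutD(2)[OF \<phi>]] M_subset one_\<Lambda>
    by (metis inj_onD subsetD)
  thus False by (simp add: M_iff mat_nth)
qed

text \<open>Applying \<open>image_M_subset\<close> to \<phi> and to its inverse puts
  \<open>M k\<close> inside some \<open>M l\<close>; then \<open>k = l\<close> by
  \<open>M_inj\<close>, which gives the reverse inclusion.\<close>

lemma image_M:
  assumes \<phi>: "\<phi> \<in> carrier Aut" shows "\<exists>j. \<phi> ` M k = M j"
proof -
  let ?\<psi> = "\<lambda>A\<in>\<Lambda>. inv_into \<Lambda> \<phi> A"
  have inv: "\<phi> (?\<psi> A) = A" "?\<psi> (\<phi> A) = A" if "A \<in> \<Lambda>" for A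
    using that AutD(2,3)[OF \<phi>] bij_betw_inv_into_left bij_betw_inv_into_right by fastforce+
  obtain j where j: "\<phi> ` M k \<subseteq> M j" using image_M_subset[OF \<phi>] by blast
  obtain l where l: "?\<psi> ` M j \<subseteq> M l" using image_M_subset[OF Aut_inv[OF \<phi>]] by blast
  have "M k \<subseteq> M l"
  proof
    fix A assume A: "A \<in> M k"
    hence "?\<psi> (\<phi> A) \<in> M l" using j l by blast
    thus "A \<in> M l" using A M_subset[of k] inv(2)[of A] by (metis subsetD)
  qed
  hence "k = l" by (rule M_inj)
  have "M j \<subseteq> \<phi> ` M k"
  proof
    fix A assume A: "A \<in> M j"
    hence "?\<psi> A \<in> M k" using l \<open>k = l\<close> by blast
    thus "A \<in> \<phi> ` M k" using A M_subset[of j] inv(1)[of A] by (metis imageI subsetD)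
  qed
  thus ?thesis using j by blast
qed

lemma perm_eqI:
  assumes \<phi>: "\<phi> \<in> carrier Aut" and \<sigma>: "\<And>k. \<phi> ` M k = M (\<sigma> k)"
  shows "bij \<sigma>" and "perm \<phi> = \<sigma>"
proof -
  have "k = l" if "\<sigma> k = \<sigma> l" for k l
  proof -
    have "\<phi> ` M k = \<phi> ` M l" using that \<sigma> by simp
    hence "M k = M l"
      using inj_on_image_eq_iff[OF bij_betw_imp_inj_on[OF AutD(2)[OF \<phi>]] M_subset M_subset] by blast
    thus ?thesis using M_inj by blast
  qed
  hence "inj \<sigma>" by (auto intro: injI)
  thus bij: "bij \<sigma>" by (simp add: bij_def finite_UNIV_inj_surj)
  show "perm \<phi> = \<sigma>" unfolding induced_perm_def
  proof (rule the_equality)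
    show "\<tau> = \<sigma>" if "bij \<tau> \<and> (\<forall>k. \<phi> ` M k = M (\<tau> k))" for \<tau>
      using that \<sigma> M_inj by (metis ext order_refl)
  qed (use bij \<sigma> in auto)
qed

lemma image_M_perm: "\<phi> \<in> carrier Aut \<Longrightarrow> \<phi> ` M k = M (perm \<phi> k)"
  using image_M perm_eqI(2) by metis

lemma bij_perm: "\<phi> \<in> carrier Aut \<Longrightarrow> bij (perm \<phi>)"
  using image_M_perm perm_eqI(1) by metis

lemma perm_compose:
  assumes "\<phi> \<in> carrier Aut" "\<psi> \<in> carrier Aut"
  shows "perm (compose \<Lambda> \<phi> \<psi>) = perm \<phi> \<circ> perm \<psi>"
proof (rule perm_eqI(2)[OF Aut_compose[OF assms]])
  fix k
  have "compose \<Lambda> \<phi> \<psi> ` M k = \<phi> ` \<psi> ` M k"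
    using M_subset[of k] by (force simp: compose_def image_image)
  thus "compose \<Lambda> \<phi> \<psi> ` M k = M ((perm \<phi> \<circ> perm \<psi>) k)"
    using assms by (simp add: image_M_perm)
qed

lemma image_ideal_prod:
  assumes \<phi>: "\<phi> \<in> carrier Aut" and "I \<subseteq> \<Lambda>" "J \<subseteq> \<Lambda>"
  shows "ideal_prod L I J \<subseteq> \<Lambda>" "\<phi> ` ideal_prod L I J = ideal_prod L (\<phi> ` I) (\<phi> ` J)"
proof -
  show sub: "ideal_prod L I J \<subseteq> \<Lambda>"
  proof
    show "A \<in> \<Lambda>" if "A \<in> ideal_prod L I J" for A
      using that by induction (use assms in \<open>auto intro: mult_\<Lambda> add_\<Lambda>\<close>)
  qed
  have "\<phi> A \<in> ideal_prod L (\<phi> ` I) (\<phi> ` J)" if "A \<in> ideal_prod L I J" for A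
    using that
  proof induction
    case (prod A B)
    hence "\<phi> (A \<otimes>\<^bsub>L\<^esub> B) = \<phi> A \<otimes>\<^bsub>L\<^esub> \<phi> B" using assms by (auto intro!: AutD(5))
    thus ?case using prod by (metis ideal_prod.prod imageI)
  next
    case (sum A B)
    hence "\<phi> (A \<oplus>\<^bsub>L\<^esub> B) = \<phi> A \<oplus>\<^bsub>L\<^esub> \<phi> B" using \<phi> sub by (auto intro!: AutD(6))
    thus ?case using sum by (metis ideal_prod.sum)
  qed
  moreover have "A \<in> \<phi> ` ideal_prod L I J" if "A \<in> ideal_prod L (\<phi> ` I) (\<phi> ` J)" for A
    using that
  proof induction
    case (prod A B)
    then obtain A' B' where "A' \<in> I" "B' \<in> J" "A = \<phi> A'" "B = \<phi> B'" by blast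
    moreover from this have "A \<otimes>\<^bsub>L\<^esub> B = \<phi> (A' \<otimes>\<^bsub>L\<^esub> B')" using assms by (auto intro!: AutD(5)[symmetric])
    ultimately show ?case by (metis ideal_prod.prod imageI)
  next
    case (sum A B)
    then obtain A' B' where "A' \<in> ideal_prod L I J" "B' \<in> ideal_prod L I J" "A = \<phi> A'" "B = \<phi> B'" by blast
    moreover from this have "A \<oplus>\<^bsub>L\<^esub> B = \<phi> (A' \<oplus>\<^bsub>L\<^esub> B')" using \<phi> sub by (auto intro!: AutD(6)[symmetric])
    ultimately show ?case by (metis ideal_prod.sum imageI)
  qed
  ultimately show "\<phi> ` ideal_prod L I J = ideal_prod L (\<phi> ` I) (\<phi> ` J)" by blast
qed

lemma Q_iff: "\<sigma> \<in> carrier Q \<longleftrightarrow> bij \<sigma> \<and> (\<forall>i j. link \<alpha> i j \<longleftrightarrow> link \<alpha> (\<sigma> i) (\<sigma> j))"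
  by (simp add: link_aut_def link_arrow_iff Bij_def)

lemma perm_in_Q: assumes \<phi>: "\<phi> \<in> carrier Aut" shows "perm \<phi> \<in> carrier Q"
proof -
  have "link_arrow R \<pi> \<alpha> (perm \<phi> i) (perm \<phi> j) \<longleftrightarrow> link_arrow R \<pi> \<alpha> i j" for i j
  proof -
    note inj = bij_betw_imp_inj_on[OF AutD(2)[OF \<phi>]]
    have "\<phi> ` ideal_prod L (M j) (M i) = ideal_prod L (M (perm \<phi> j)) (M (perm \<phi> i))"
      using image_ideal_prod(2)[OF \<phi> M_subset M_subset] by (simp add: image_M_perm[OF \<phi>])
    moreover have "\<phi> ` (M j \<inter> M i) = M (perm \<phi> j) \<inter> M (perm \<phi> i)"
      using inj_on_image_Int[OF inj M_subset M_subset] by (simp add: image_M_perm[OF \<phi>])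
    moreover have "\<phi> ` ideal_prod L (M j) (M i) = \<phi> ` (M j \<inter> M i) \<longleftrightarrow> ideal_prod L (M j) (M i) = M j \<inter> M i"
      by (rule inj_on_image_eq_iff[OF inj image_ideal_prod(1)[OF \<phi> M_subset M_subset]])
         (use M_subset in blast)
    ultimately show ?thesis unfolding link_arrow_def by simp
  qed
  thus ?thesis using bij_perm[OF \<phi>] by (simp add: Q_iff link_arrow_iff)
qed

lemma group_Q: "Group.group Q"
proof -
  have "subgroup (carrier Q) (BijGroup UNIV)"
  proof
    show "inv\<^bsub>BijGroup UNIV\<^esub> \<sigma> \<in> carrier Q" if "\<sigma> \<in> carrier Q" for \<sigma>
    proof -
      have "bij \<sigma>" "link \<alpha> (inv_into UNIV \<sigma> i) (inv_into UNIV \<sigma> j) \<longleftrightarrow> link \<alpha> i j" for i j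
        using that bij_is_surj[THEN surj_f_inv_f] by (metis Q_iff)+
      thus ?thesis by (simp add: inv_BijGroup Bij_def Q_iff bij_imp_bij_inv)
    qed
  qed (auto simp: BijGroup_def Q_iff Bij_def compose_def restrict_def bij_comp[unfolded comp_def] bij_id[unfolded id_def])
  from group.subgroup_imp_group[OF group_BijGroup this] show ?thesis by (simp add: link_aut_def)
qed

lemma Q_mult: "\<sigma> \<in> carrier Q \<Longrightarrow> \<tau> \<in> carrier Q \<Longrightarrow> \<sigma> \<otimes>\<^bsub>Q\<^esub> \<tau> = \<sigma> \<circ> \<tau>"
  by (simp add: link_aut_def BijGroup_def compose_def comp_def restrict_def Bij_def)

lemma Q_one: "\<one>\<^bsub>Q\<^esub> = id"
  by (simp add: link_aut_def BijGroup_def id_def restrict_def)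

lemma perm_hom: "perm \<in> hom Aut Q"
  by (rule homI) (simp_all add: perm_in_Q Aut_mult Q_mult perm_compose)

end

section \<open>Lifting link graph automorphisms\<close>

context zero_one_tiled_order
begin

text \<open>Entries are fetched through the inverse permutation; \<open>lift_nth\<close> is the
  working form. The power is an integer power because exponents may drop, and the restriction
  provides the extensionality that \<open>BijGroup\<close> demands.\<close>

definition lift :: "('n \<Rightarrow> 'n) \<Rightarrow> 'k^'n^'n \<Rightarrow> 'k^'n^'n" where
  "lift \<sigma> = (\<lambda>A\<in>\<Lambda>. \<chi> i j. let i' = inv_into UNIV \<sigma> i; j' = inv_into UNIV \<sigma> j in
     \<pi> powi (int (\<alpha> i j) - int (\<alpha> i' j')) * A $ i' $ j')"

lemma lift_nth:
  assumes "bij \<sigma>" "A \<in> \<Lambda>"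
  shows "lift \<sigma> A $ \<sigma> i $ \<sigma> j = \<pi> powi (int (\<alpha> (\<sigma> i) (\<sigma> j)) - int (\<alpha> i j)) * A $ i $ j"
  using assms by (simp add: lift_def bij_is_inj)

lemma vec_eq_bijI:
  assumes "bij \<sigma>" "\<And>i j. A $ \<sigma> i $ \<sigma> j = B $ \<sigma> i $ \<sigma> j" shows "A = B"
  using assms bij_is_surj unfolding vec_eq_iff by (metis surjD)

lemma lift_\<Lambda>:
  assumes "bij \<sigma>" "A \<in> \<Lambda>" shows "lift \<sigma> A \<in> \<Lambda>"
proof -
  have "lift \<sigma> A $ \<sigma> i $ \<sigma> j \<in> V (\<alpha> (\<sigma> i) (\<sigma> j))" for i j
    unfolding lift_nth[OF assms] using \<Lambda>_nth[OF assms(2)] by (rule pi_powi_mult_V) simp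
  thus ?thesis unfolding \<Lambda>_iff using bij_is_surj[OF assms(1)] by (metis surjD)
qed

text \<open>The exponent differences telescope, so lifts compose exactly and not just up to inner
  automorphisms; this makes the extension split.\<close>

lemma lift_comp:
  assumes "bij \<sigma>" "bij \<tau>" shows "lift (\<sigma> \<circ> \<tau>) = compose \<Lambda> (lift \<sigma>) (lift \<tau>)"
proof
  fix A
  show "lift (\<sigma> \<circ> \<tau>) A = compose \<Lambda> (lift \<sigma>) (lift \<tau>) A"
  proof (cases "A \<in> \<Lambda>")
    case True
    show ?thesis
    proof (rule vec_eq_bijI[OF bij_comp[OF assms(2,1)]])
      fix i j
      show "lift (\<sigma> \<circ> \<tau>) A $ (\<sigma> \<circ> \<tau>) i $ (\<sigma> \<circ> \<tau>) j = compose \<Lambda> (lift \<sigma>) (lift \<tau>) A $ (\<sigma> \<circ> \<tau>) i $ (\<sigma> \<circ> \<tau>) j"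
        unfolding lift_nth[OF bij_comp[OF assms(2,1)] True]
        using True assms by (simp add: compose_def lift_nth lift_\<Lambda> flip: mult.assoc power_int_add)
    qed
  qed (simp add: lift_def compose_def)
qed

lemma lift_id: "A \<in> \<Lambda> \<Longrightarrow> lift id A = A"
  by (simp add: lift_def vec_eq_iff)

text \<open>The exponents transported along \<sigma> have the same links as \<alpha> because
  \<sigma> preserves the link graph, so \<open>link_determines_exponents\<close> applies.\<close>

lemma Q_potential:
  assumes \<sigma>: "\<sigma> \<in> carrier Q"
  obtains u :: "'n \<Rightarrow> int" where "\<And>i j. int (\<alpha> (\<sigma> i) (\<sigma> j)) - int (\<alpha> i j) = u j - u i"
proof -
  have bij: "bij \<sigma>" and links: "link \<alpha> (\<sigma> i) (\<sigma> j) \<longleftrightarrow> link \<alpha> i j" for i j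
    using \<sigma> by (auto simp: Q_iff)
  have inj: "\<sigma> x = \<sigma> y \<longleftrightarrow> x = y" for x y using bij_is_inj[OF bij] by (auto dest: injD)
  define \<beta> where "\<beta> i j = \<alpha> (\<sigma> i) (\<sigma> j)" for i j
  have "zero_one_exponents \<beta>"
  proof
    show "\<beta> i j = 0 \<Longrightarrow> \<beta> j i = 0 \<Longrightarrow> i = j" for i j
      using antisym[of "\<sigma> i" "\<sigma> j"] by (simp add: \<beta>_def inj)
  qed (simp_all only: \<beta>_def diag triangle le_1)
  moreover have "link \<beta> i j \<longleftrightarrow> link \<alpha> (\<sigma> i) (\<sigma> j)" for i j
  proof -
    have "(\<forall>k. P (\<sigma> k)) \<longleftrightarrow> (\<forall>k. P k)" for P using bij_is_surj[OF bij] by (metis surjD)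
    from this[of "\<lambda>k. k \<noteq> \<sigma> i \<longrightarrow> k \<noteq> \<sigma> j \<longrightarrow> \<alpha> (\<sigma> j) (\<sigma> i) + (if i = j then 1 else 0) < \<alpha> (\<sigma> j) k + \<alpha> k (\<sigma> i)"]
    show ?thesis by (simp add: link_def \<beta>_def inj)
  qed
  hence "link \<alpha> = link \<beta>" using links by (auto simp: fun_eq_iff)
  ultimately obtain u :: "'n \<Rightarrow> int" where "int (\<beta> i j) = int (\<alpha> i j) + u j - u i" for i j
    using link_determines_exponents zero_one_exponents_axioms by blast
  thus thesis by (intro that[of u]) (simp add: \<beta>_def)
qed

text \<open>Multiplicativity is where the cocycle identity for \<open>\<alpha> (\<sigma> i) (\<sigma> j) - \<alpha> i j\<close> enters.\<close>

lemma lift_mult: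
  assumes \<sigma>: "\<sigma> \<in> carrier Q" and A: "A \<in> \<Lambda>" and B: "B \<in> \<Lambda>"
  shows "lift \<sigma> (A ** B) = lift \<sigma> A ** lift \<sigma> B"
proof -
  have bij: "bij \<sigma>" using \<sigma> by (simp add: Q_iff)
  obtain u :: "'n \<Rightarrow> int" where u: "\<And>i j. int (\<alpha> (\<sigma> i) (\<sigma> j)) - int (\<alpha> i j) = u j - u i"
    using Q_potential[OF \<sigma>] by blast
  note nth = lift_nth[OF bij, unfolded u]
  show ?thesis
  proof (rule vec_eq_bijI[OF bij])
    fix i j
    have "(lift \<sigma> A ** lift \<sigma> B) $ \<sigma> i $ \<sigma> j = (\<Sum>k\<in>UNIV. lift \<sigma> A $ \<sigma> i $ \<sigma> k * lift \<sigma> B $ \<sigma> k $ \<sigma> j)"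
      unfolding matrix_mult_nth
      using sum.reindex_bij_betw[OF bij, of "\<lambda>k. lift \<sigma> A $ \<sigma> i $ k * lift \<sigma> B $ k $ \<sigma> j"] by simp
    also have "\<dots> = (\<Sum>k\<in>UNIV. \<pi> powi (u j - u i) * (A $ i $ k * B $ k $ j))"
    proof (rule sum.cong)
      fix k
      have "\<pi> powi (u k - u i) * \<pi> powi (u j - u k) = \<pi> powi (u j - u i)"
        by (simp flip: power_int_add)
      thus "lift \<sigma> A $ \<sigma> i $ \<sigma> k * lift \<sigma> B $ \<sigma> k $ \<sigma> j = \<pi> powi (u j - u i) * (A $ i $ k * B $ k $ j)"
        by (simp add: nth A B mult.assoc mult.left_commute) (metis mult.assoc mult.commute)
    qed simp
    also have "\<dots> = lift \<sigma> (A ** B) $ \<sigma> i $ \<sigma> j"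
      by (simp add: nth A B mult_\<Lambda> matrix_mult_nth sum_distrib_left)
    finally show "lift \<sigma> (A ** B) $ \<sigma> i $ \<sigma> j = (lift \<sigma> A ** lift \<sigma> B) $ \<sigma> i $ \<sigma> j" by simp
  qed
qed

lemma lift_Aut:
  assumes \<sigma>: "\<sigma> \<in> carrier Q" shows "lift \<sigma> \<in> carrier Aut"
proof -
  have bij: "bij \<sigma>" and bij': "bij (inv_into UNIV \<sigma>)"
    using \<sigma> by (simp_all add: Q_iff bij_imp_bij_inv)
  show ?thesis
  proof (rule AutI[where \<psi> = "lift (inv_into UNIV \<sigma>)"])
    show "lift \<sigma> (lift (inv_into UNIV \<sigma>) A) = A" "lift (inv_into UNIV \<sigma>) (lift \<sigma> A) = A" if "A \<in> \<Lambda>" for A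
      using that lift_comp[OF bij bij', THEN fun_cong, of A] lift_comp[OF bij' bij, THEN fun_cong, of A]
      by (simp_all add: lift_id surj_iff[THEN iffD1] inj_iff[THEN iffD1] bij bij_is_surj bij_is_inj compose_def)
    show "lift \<sigma> (mat 1) = mat 1"
      by (rule vec_eq_bijI[OF bij]) (auto simp: lift_nth bij mat_nth bij_is_inj[OF bij] inj_eq)
    show "lift \<sigma> (A + B) = lift \<sigma> A + lift \<sigma> B" if "A \<in> \<Lambda>" "B \<in> \<Lambda>" for A B
      by (rule vec_eq_bijI[OF bij]) (simp add: lift_nth bij that add_\<Lambda> distrib_left)
    show "lift \<sigma> (map_matrix ((*) r) A) = map_matrix ((*) r) (lift \<sigma> A)" if "r \<in> R" "A \<in> \<Lambda>" for r A
      by (rule vec_eq_bijI[OF bij]) (simp add: lift_nth bij that scale_\<Lambda> mult.left_commute)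
  qed (simp_all add: lift_\<Lambda> lift_mult bij bij' \<sigma>, simp add: lift_def)
qed

text \<open>Diagonal exponents are 0, so the diagonal entry at \<open>k\<close> is moved to
  \<open>\<sigma> k\<close> unscaled. This gives one inclusion, which suffices by
  \<open>image_M\<close> and \<open>M_inj\<close>.\<close>

lemma perm_lift:
  assumes \<sigma>: "\<sigma> \<in> carrier Q" shows "perm (lift \<sigma>) = \<sigma>"
proof (rule perm_eqI(2)[OF lift_Aut[OF \<sigma>]])
  fix k
  have bij: "bij \<sigma>" using \<sigma> by (simp add: Q_iff)
  obtain j where j: "lift \<sigma> ` M k = M j" using image_M[OF lift_Aut[OF \<sigma>]] by blast
  have "lift \<sigma> ` M k \<subseteq> M (\<sigma> k)"
    using lift_\<Lambda>[OF bij] by (auto simp: M_iff lift_nth bij)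
  thus "lift \<sigma> ` M k = M (\<sigma> k)" using j M_inj by metis
qed

lemma lift_hom: "lift \<in> hom Q Aut"
  by (rule homI) (simp_all add: lift_Aut Aut_mult Q_mult lift_comp Q_iff[THEN iffD1])

section \<open>Inner automorphisms and the kernel of the action\<close>

lemma Inn_iff:
  "\<phi> \<in> carrier Inn \<longleftrightarrow>
     (\<exists>g\<in>\<Lambda>. \<exists>h\<in>\<Lambda>. g ** h = mat 1 \<and> h ** g = mat 1 \<and> \<phi> = (\<lambda>A\<in>\<Lambda>. g ** A ** h))"
proof -
  interpret L: monoid L
    by unfold_locales (auto simp: mult_\<Lambda> matrix_mul_assoc)
  have inv: "inv\<^bsub>L\<^esub> g = h" if "g \<in> \<Lambda>" "h \<in> \<Lambda>" "g ** h = mat 1" "h ** g = mat 1" for g h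
    using L.inv_char[of g h] that by simp
  show ?thesis
  proof
    assume "\<phi> \<in> carrier Inn"
    then obtain g where g: "g \<in> Units L" "\<phi> = (\<lambda>A\<in>\<Lambda>. g ** A ** inv\<^bsub>L\<^esub> g)"
      by (auto simp: inner_aut_def)
    then obtain h where h: "g \<in> \<Lambda>" "h \<in> \<Lambda>" "g ** h = mat 1" "h ** g = mat 1"
      by (auto simp: Units_def)
    thus "\<exists>g\<in>\<Lambda>. \<exists>h\<in>\<Lambda>. g ** h = mat 1 \<and> h ** g = mat 1 \<and> \<phi> = (\<lambda>A\<in>\<Lambda>. g ** A ** h)"
      using g(2) inv[OF h] by metis
  next
    assume "\<exists>g\<in>\<Lambda>. \<exists>h\<in>\<Lambda>. g ** h = mat 1 \<and> h ** g = mat 1 \<and> \<phi> = (\<lambda>A\<in>\<Lambda>. g ** A ** h)"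
    then obtain g h where gh: "g \<in> \<Lambda>" "h \<in> \<Lambda>" "g ** h = mat 1" "h ** g = mat 1" "\<phi> = (\<lambda>A\<in>\<Lambda>. g ** A ** h)"
      by blast
    hence "g \<in> Units L" by (auto simp: Units_def)
    moreover have "\<phi> = (\<lambda>A\<in>\<Lambda>. g ** A ** inv\<^bsub>L\<^esub> g)" using gh inv[OF gh(1-4)] by simp
    ultimately show "\<phi> \<in> carrier Inn" unfolding inner_aut_def by auto
  qed
qed

lemma Inn_subset_kernel: assumes "\<phi> \<in> carrier Inn" shows "\<phi> \<in> kernel Aut Q perm"
proof -
  obtain g h where g: "g \<in> \<Lambda>" and h: "h \<in> \<Lambda>" and gh: "g ** h = mat 1" "h ** g = mat 1"
    and \<phi>_eq: "\<phi> = (\<lambda>A\<in>\<Lambda>. g ** A ** h)"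
    using assms unfolding Inn_iff by blast
  have cancel: "X ** h ** g = X" "X ** g ** h = X" for X
    by (simp_all add: gh flip: matrix_mul_assoc)
  have \<phi>: "\<phi> \<in> carrier Aut"
  proof (rule AutI[where \<psi> = "\<lambda>A. h ** A ** g"])
    show "\<phi> (map_matrix ((*) r) A) = map_matrix ((*) r) (\<phi> A)" if "r \<in> R" "A \<in> \<Lambda>" for r A
      using that
      by (simp add: \<phi>_eq scale_\<Lambda> vec_eq_iff matrix_mult_nth sum_distrib_left sum_distrib_right mult_ac)
  qed (simp_all add: \<phi>_eq g h mult_\<Lambda> add_\<Lambda> matrix_mul_assoc gh cancel matrix_add_ldistrib matrix_add_rdistrib)
  have "\<phi> ` M k = M k" for k
  proof -
    obtain j where "\<phi> ` M k = M j" using image_M[OF \<phi>] by blast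
    moreover have "\<phi> ` M k \<subseteq> M k"
      using g h M_subset mult_M_left mult_M_right by (auto simp: \<phi>_eq)
    ultimately show ?thesis using M_inj by metis
  qed
  hence "perm \<phi> = id" using perm_eqI(2)[OF \<phi>, of id] by simp
  thus ?thesis using \<phi> by (simp add: kernel_def Q_one)
qed

text \<open>An automorphism fixing the diagonal idempotents acts on each entry by a scalar \<open>c i j\<close>, and
  \<open>c i k = c i j * c j k\<close>; hence it is conjugation by a diagonal matrix.\<close>

lemma conj_diag_if_fixes_idempotents:
  assumes \<psi>: "\<And>A. A \<in> \<Lambda> \<Longrightarrow> \<psi> A \<in> \<Lambda>" "\<psi> (mat 1) = mat 1"
      "\<And>A B. A \<in> \<Lambda> \<Longrightarrow> B \<in> \<Lambda> \<Longrightarrow> \<psi> (A ** B) = \<psi> A ** \<psi> B"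
      "\<And>r A. r \<in> R \<Longrightarrow> A \<in> \<Lambda> \<Longrightarrow> \<psi> (map_matrix ((*) r) A) = map_matrix ((*) r) (\<psi> A)"
    and idem: "\<And>i. \<psi> (munit i i 1) = munit i i 1"
  obtains d e where "d \<in> \<Lambda>" "e \<in> \<Lambda>" "d ** e = mat 1" "e ** d = mat 1"
    "\<And>A. A \<in> \<Lambda> \<Longrightarrow> \<psi> A = d ** A ** e"
proof -
  define N where "N i j = munit i j (\<pi> ^ \<alpha> i j)" for i j
  have N: "N i j \<in> \<Lambda>" for i j by (simp add: N_def munit_\<Lambda>)
  \<comment> \<open>The scalar is read off at the generator \<open>N i j\<close> of position (i, j);
    the image stays in the order, so the quotient lies in R.\<close>
  define c where "c i j = \<psi> (N i j) $ i $ j / \<pi> ^ \<alpha> i j" for i j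
  have c_R: "c i j \<in> R" for i j
    using \<Lambda>_nth[OF \<psi>(1)[OF N], of i j i j] by (simp add: c_def V_iff)
  have \<psi>_nth: "\<psi> A $ i $ j = c i j * A $ i $ j" if A: "A \<in> \<Lambda>" for A i j
  proof -
    obtain r where r: "r \<in> R" "A $ i $ j = \<pi> ^ \<alpha> i j * r"
      using \<Lambda>_nth[OF A, of i j] by (auto simp: prime_power_def)
    have "munit i i 1 ** A ** munit j j 1 = map_matrix ((*) r) (N i j)"
      by (simp add: munit_mult_mult_munit r N_def vec_eq_iff)
    hence "map_matrix ((*) r) (\<psi> (N i j)) = munit i i 1 ** \<psi> A ** munit j j 1"
      using \<psi>(4)[OF r(1) N[of i j]] A by (metis \<psi>(3) idem munit_1_\<Lambda> mult_\<Lambda>)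
    hence "(map_matrix ((*) r) (\<psi> (N i j))) $ i $ j = \<psi> A $ i $ j"
      by (simp add: munit_mult_mult_munit)
    thus ?thesis by (simp add: c_def r mult.commute)
  qed
  have \<psi>_N: "\<psi> (N i j) $ a $ b = (if a = i \<and> b = j then c i j * \<pi> ^ \<alpha> i j else 0)" for i j a b
    unfolding \<psi>_nth[OF N] by (simp add: N_def)
  have c_mult: "c i k = c i j * c j k" for i j k
  proof -
    have prod: "N i j ** N j k = munit i k (\<pi> ^ \<alpha> i j * \<pi> ^ \<alpha> j k)"
      by (simp add: N_def munit_mult_munit)
    have "\<psi> (N i j ** N j k) $ i $ k = (\<Sum>l\<in>UNIV. \<psi> (N i j) $ i $ l * \<psi> (N j k) $ l $ k)"
      by (simp add: \<psi>(3) N matrix_mult_nth)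
    also have "\<dots> = (\<Sum>l\<in>UNIV. if l = j then c i j * \<pi> ^ \<alpha> i j * (c j k * \<pi> ^ \<alpha> j k) else 0)"
      by (intro sum.cong) (auto simp: \<psi>_N)
    finally have "c i j * c j k * (\<pi> ^ \<alpha> i j * \<pi> ^ \<alpha> j k) = \<psi> (N i j ** N j k) $ i $ k"
      by (simp add: mult_ac)
    also have "\<dots> = c i k * (\<pi> ^ \<alpha> i j * \<pi> ^ \<alpha> j k)"
      by (subst \<psi>_nth[OF mult_\<Lambda>[OF N N]]) (simp add: prod)
    finally show ?thesis by simp
  qed
  have c_1: "c i i = 1" for i
    using \<psi>_nth[OF one_\<Lambda>, of i i] by (simp add: \<psi>(2) mat_nth)
  \<comment> \<open>Any vertex serves as base point; \<open>undefined\<close> merely names one. The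
    cocycle rule splits \<open>c i j\<close> into \<open>c i z * c z j\<close>, whose factors are
    diagonal entries of \<open>d\<close> and \<open>e\<close>.\<close>
  define z :: 'n where "z = undefined"
  define d where "d = (\<chi> i j. if i = j then c i z else 0)"
  define e where "e = (\<chi> i j. if i = j then c z i else 0)"
  have "d \<in> \<Lambda>" "e \<in> \<Lambda>" unfolding d_def e_def by (intro diag_\<Lambda> c_R)+
  moreover have "(d ** e) $ i $ j = mat 1 $ i $ j" for i j
    unfolding d_def diag_mult_nth by (simp add: e_def mat_nth c_1 flip: c_mult)
  hence "d ** e = mat 1" by (simp add: vec_eq_iff)
  moreover have "e ** d = mat 1" using matrix_left_right_inverse calculation by blast
  moreover have "\<psi> A = d ** A ** e" if "A \<in> \<Lambda>" for A
    unfolding vec_eq_iff d_def e_def diag_mult_mult_nth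
  proof (intro allI)
    show "\<psi> A $ i $ j = c i z * A $ i $ j * c z j" for i j
      unfolding \<psi>_nth[OF that] c_mult[of i j z] by (simp only: mult_ac)
  qed
  ultimately show thesis using that by blast
qed

text \<open>If \<open>\<phi>\<close> fixes every maximal ideal, then \<open>u = (\<Sum>i. \<phi> (E i i) ** E i i)\<close> is congruent to the identity modulo
  the radical, hence a unit, and it conjugates \<open>\<phi> (E i i)\<close> to \<open>E i i\<close>.\<close>

lemma kernel_subset_Inn: assumes "\<phi> \<in> kernel Aut Q perm" shows "\<phi> \<in> carrier Inn"
proof -
  have \<phi>: "\<phi> \<in> carrier Aut" and "perm \<phi> = id" using assms by (auto simp: kernel_def Q_one)
  hence image: "\<phi> ` M k = M k" for k using image_M_perm[OF \<phi>, of k] by simp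
  note D = AutD[OF \<phi>]
  define f where "f i = \<phi> (munit i i 1)" for i
  have f: "f i \<in> \<Lambda>" for i by (simp add: f_def D)
  have f_mult: "f i ** f j = (if i = j then f i else 0)" for i j
  proof -
    have "munit i i 1 ** munit j j (1::'k) = (if i = j then munit i i 1 else 0)"
      by (auto simp: vec_eq_iff)
    hence "\<phi> (munit i i 1 ** munit j j 1) = (if i = j then f i else 0)"
      by (simp add: f_def Aut_zero[OF \<phi>])
    thus ?thesis by (simp add: f_def D)
  qed
  define u where "u = (\<Sum>i\<in>UNIV. f i ** munit i i 1)"
  have u: "u \<in> \<Lambda>" unfolding u_def by (intro sum_\<Lambda> mult_\<Lambda> f munit_1_\<Lambda>)
  have u_nth: "u $ a $ b = f b $ a $ b" for a b
    by (simp add: u_def)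
  \<comment> \<open>Otherwise \<open>f i\<close> would lie in \<open>M i\<close>, which \<phi> maps
    onto itself, and so would the idempotent at \<open>i\<close>.\<close>
  have "u $ i $ i \<notin> V 1" for i
  proof
    assume "u $ i $ i \<in> V 1"
    hence "f i \<in> \<phi> ` M i" using f by (simp add: M_iff u_nth image)
    hence "munit i i 1 \<in> M i"
      unfolding f_def inj_on_image_mem_iff[OF bij_betw_imp_inj_on[OF D(2)] munit_1_\<Lambda> M_subset] .
    thus False by (simp add: munit_1_M_iff)
  qed
  then obtain w where w: "w \<in> \<Lambda>" "w ** u = mat 1" using left_inverse_if_unit_diag u by blast
  hence uw: "u ** w = mat 1" using matrix_left_right_inverse by blast
  \<comment> \<open>Both sides reduce to \<open>f i ** munit i i 1\<close>, as the
    \<open>f i\<close> are orthogonal idempotents.\<close>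
  have fu: "f i ** u = u ** munit i i 1" for i
  proof -
    have "f i ** u = (\<Sum>j\<in>UNIV. f i ** (f j ** munit j j 1))"
      by (simp add: u_def matrix_mult_sum_distrib)
    also have "\<dots> = (\<Sum>j\<in>UNIV. if j = i then f i ** munit i i 1 else 0)"
      by (intro sum.cong) (auto simp: matrix_mul_assoc f_mult matrix_mult_0_left)
    also have "\<dots> = u ** munit i i 1"
      by (auto simp: vec_eq_iff u_nth)
    finally show ?thesis .
  qed
  define \<psi> where "\<psi> A = w ** \<phi> A ** u" for A
  have cancel: "X ** u ** w = X" "X ** w ** u = X" for X
    by (simp_all add: w uw flip: matrix_mul_assoc)
  have \<phi>_\<psi>: "\<phi> A = u ** \<psi> A ** w" for A
    by (simp add: \<psi>_def matrix_mul_assoc uw cancel)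
  obtain d e where de: "d \<in> \<Lambda>" "e \<in> \<Lambda>" "d ** e = mat 1" "e ** d = mat 1"
    and \<psi>: "\<And>A. A \<in> \<Lambda> \<Longrightarrow> \<psi> A = d ** A ** e"
  proof (rule conj_diag_if_fixes_idempotents[of \<psi>])
    show "\<psi> (munit i i 1) = munit i i 1" for i
      using fu[of i] by (simp add: \<psi>_def w flip: f_def matrix_mul_assoc) (simp add: w matrix_mul_assoc)
    show "\<psi> (map_matrix ((*) r) A) = map_matrix ((*) r) (\<psi> A)" if "r \<in> R" "A \<in> \<Lambda>" for r A
      using that
      by (simp add: \<psi>_def D vec_eq_iff matrix_mult_nth sum_distrib_left sum_distrib_right mult_ac)
  qed (simp_all add: \<psi>_def D mult_\<Lambda> u w matrix_mul_assoc uw cancel)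
  show ?thesis unfolding Inn_iff
  proof (rule bexI[of _ "u ** d"], rule bexI[of _ "e ** w"], intro conjI)
    show "u ** d \<in> \<Lambda>" "e ** w \<in> \<Lambda>" using u w de by (simp_all add: mult_\<Lambda>)
    have cancel': "X ** d ** e = X" for X
      by (simp add: de flip: matrix_mul_assoc)
    show "u ** d ** (e ** w) = mat 1" "e ** w ** (u ** d) = mat 1"
      by (simp_all add: matrix_mul_assoc cancel cancel' de uw)
    show "\<phi> = (\<lambda>A\<in>\<Lambda>. u ** d ** A ** (e ** w))"
    proof (rule extensionalityI[of _ \<Lambda>])
      show "\<phi> \<in> extensional \<Lambda>" using D(1) by (simp add: Bij_def)
      show "\<phi> A = (\<lambda>A\<in>\<Lambda>. u ** d ** A ** (e ** w)) A" if "A \<in> \<Lambda>" for A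
        using that by (simp add: \<phi>_\<psi>[of A] \<psi> matrix_mul_assoc)
    qed simp
  qed
qed

lemma Inn_eq_kernel: "Inn = Aut\<lparr>carrier := kernel Aut Q perm\<rparr>"
proof -
  have "carrier Inn = kernel Aut Q perm" using Inn_subset_kernel kernel_subset_Inn by blast
  moreover have "Inn = Aut\<lparr>carrier := carrier Inn\<rparr>" by (simp add: inner_aut_def)
  ultimately show ?thesis by simp
qed

end

theorem theorem8:
  fixes R P :: "'k::field set" and \<pi> :: 'k
    and \<alpha> :: "'n::finite \<Rightarrow> 'n \<Rightarrow> nat"
  assumes "discrete_valuation_ring R"
    and "has_quotient_field_UNIV R"
    and "\<pi> \<in> R"
    and "P = PIdl\<^bsub>subring_of_field R\<^esub> \<pi>"
    and "maximalideal P (subring_of_field R)"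
    and "adically_complete R \<pi>"
    and "tiled_exponents \<alpha>"
    and "basic_exponents \<alpha>"
    and "\<And>i j. \<alpha> i j \<in> {0, 1}"
  shows "(\<forall>\<sigma>\<in>carrier (link_aut R \<pi> \<alpha>). liftable R \<pi> \<alpha> \<sigma>) \<and>
    (\<exists>s \<theta>.
       s \<in> hom (link_aut R \<pi> \<alpha>) (order_aut R \<pi> \<alpha>) \<and>
       (\<forall>\<sigma>\<in>carrier (link_aut R \<pi> \<alpha>). induced_perm R \<pi> \<alpha> (s \<sigma>) = \<sigma>) \<and>
       \<theta> \<in> hom (link_aut R \<pi> \<alpha>) (AutoGroup (inner_aut R \<pi> \<alpha>)) \<and>
       (\<forall>\<sigma>\<in>carrier (link_aut R \<pi> \<alpha>). \<forall>\<psi>\<in>carrier (inner_aut R \<pi> \<alpha>).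
          \<theta> \<sigma> \<psi> = s \<sigma> \<otimes>\<^bsub>order_aut R \<pi> \<alpha>\<^esub> \<psi> \<otimes>\<^bsub>order_aut R \<pi> \<alpha>\<^esub> inv\<^bsub>order_aut R \<pi> \<alpha>\<^esub> (s \<sigma>)) \<and>
       order_aut R \<pi> \<alpha> \<cong> semidirect_product (inner_aut R \<pi> \<alpha>) (link_aut R \<pi> \<alpha>) \<theta>)"
proof -
  interpret dvr R \<pi>
    using dvr_of_discrete_valuation_ring assms(1,3,4,5) by blast
  interpret zero_one_tiled_order R \<pi> \<alpha>
  proof
    show "\<alpha> i j = 0 \<Longrightarrow> \<alpha> j i = 0 \<Longrightarrow> i = j" for i j
      using assms(8) by (force simp: basic_exponents_def)
    show "\<alpha> i j \<le> 1" for i j using assms(9)[of i j] by auto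
  qed (use assms(7) in \<open>auto simp: tiled_exponents_def\<close>)
  have "liftable R \<pi> \<alpha> \<sigma>" if "\<sigma> \<in> carrier Q" for \<sigma>
    using lift_Aut[OF that] perm_lift[OF that] unfolding liftable_def by (metis imageI)
  moreover define \<theta> where "\<theta> = (\<lambda>\<sigma>. \<lambda>\<psi>\<in>carrier Inn. lift \<sigma> \<otimes>\<^bsub>Aut\<^esub> \<psi> \<otimes>\<^bsub>Aut\<^esub> inv\<^bsub>Aut\<^esub> (lift \<sigma>))"
  \<comment> \<open>Once the inner automorphisms are rewritten as the kernel of \<open>perm\<close>,
    this is the split extension with section \<open>lift\<close>.\<close>
  have "\<theta> \<in> hom Q (AutoGroup Inn)" "Aut \<cong> semidirect_product Inn Q \<theta>"
    unfolding \<theta>_def Inn_eq_kernel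
    by (rule semidirect_product_of_split_hom; fact group_Aut group_Q lift_hom perm_hom perm_lift)+
  moreover have "\<theta> \<sigma> \<psi> = lift \<sigma> \<otimes>\<^bsub>Aut\<^esub> \<psi> \<otimes>\<^bsub>Aut\<^esub> inv\<^bsub>Aut\<^esub> (lift \<sigma>)" if "\<psi> \<in> carrier Inn" for \<sigma> \<psi>
    using that by (simp add: \<theta>_def)
  ultimately show ?thesis using lift_hom perm_lift by blast
qed

end
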